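(* (Top trench reduction theorem) Let $T$ be a top trench. Then the set $T\cap([0,W]\times[0,h_{\text{BL}}-3h_{\text{max}}])$ can be covered by at most four copies of the squares adjacent to $T$ (a union of translates of squares adjacent to $T$, each used at most four times).
   Context: Consider an instance of the Square Strip Packing Problem with strip width $W$ and an ordering $S_1,\dots,S_n$ with its bottom-left packing (each square in turn is placed, without overlapping interiors and inside $[0,W]\times[0,\infty)$, at the feasible position $(x,y)$ with $(y,x)$ lexicographically minimal). Squares are closed sets. $h_{\text{BL}}$ is the height of the packing and $h_{\text{max}}$ the largest side length of a square. $i$-pieces: inductively for $i=1,\dots,n$, the $i$-pieces are the bounded connected components of $([0,W]\times[0,\infty))\setminus\big(\bigcup_{j\le i}S_j\cup\bigcup\{\text{$k$-pieces},\,k<i\}\big)$; $\mathcal{U}$ denotes the set of all unoccupied pieces (all $i$-pieces for all $i$). A trench is a connected maximal subset (connected component) of $([0,W]\times[0,h_{\text{BL}}-h_{\text{max}}])\setminus\big(\bigcup_j S_j\cup\bigcup\mathcal{U}\big)$. The right trench is the unique trench adjacent to the right strip boundary $\{W\}\times\mathbb{R}_{\ge0}$; all other trenches are top trenches. A square is adjacent to $T$ if it meets $\overline T$. *)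

theory Defs
  imports "HOL-Analysis.Analysis"
begin

text \<open>Square strip packing. Squares are indexed 0..n-1 (paper: 1..n);
 square i has side length s i and bottom-left corner p i.\<close>

definition sqr :: "real \<times> real \<Rightarrow> real \<Rightarrow> (real \<times> real) set" where
  "sqr q a = {fst q .. fst q + a} \<times> {snd q .. snd q + a}"

definition strip :: "real \<Rightarrow> (real \<times> real) set" where
  "strip W = {z. 0 \<le> fst z \<and> fst z \<le> W \<and> 0 \<le> snd z}"

definition feasible :: "real \<Rightarrow> (nat \<Rightarrow> real) \<Rightarrow> (nat \<Rightarrow> real \<times> real) \<Rightarrow> nat \<Rightarrow> real \<times> real \<Rightarrow> bool" where
  "feasible W s p i q \<longleftrightarrow> sqr q (s i) \<subseteq> strip W \<and>
     (\<forall>j<i. interior (sqr q (s i)) \<inter> interior (sqr (p j) (s j)) = {})"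

definition is_BL_packing :: "real \<Rightarrow> nat \<Rightarrow> (nat \<Rightarrow> real) \<Rightarrow> (nat \<Rightarrow> real \<times> real) \<Rightarrow> bool" where
  "is_BL_packing W n s p \<longleftrightarrow> (\<forall>i<n. feasible W s p i (p i) \<and>
     (\<forall>q. feasible W s p i q \<longrightarrow>
        snd (p i) < snd q \<or> (snd (p i) = snd q \<and> fst (p i) \<le> fst q)))"

fun UP :: "real \<Rightarrow> (nat \<Rightarrow> real) \<Rightarrow> (nat \<Rightarrow> real \<times> real) \<Rightarrow> nat \<Rightarrow> (real \<times> real) set" where
  "UP W s p 0 = {}"
| "UP W s p (Suc k) = UP W s p k \<union>
     \<Union> {C \<in> components (strip W - ((\<Union>j\<le>k. sqr (p j) (s j)) \<union> UP W s p k)). bounded C}"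

definition pieces :: "real \<Rightarrow> (nat \<Rightarrow> real) \<Rightarrow> (nat \<Rightarrow> real \<times> real) \<Rightarrow> nat \<Rightarrow> (real \<times> real) set set" where
  "pieces W s p k = {C \<in> components (strip W - ((\<Union>j\<le>k. sqr (p j) (s j)) \<union> UP W s p k)). bounded C}"

definition unoccupied :: "real \<Rightarrow> nat \<Rightarrow> (nat \<Rightarrow> real) \<Rightarrow> (nat \<Rightarrow> real \<times> real) \<Rightarrow> (real \<times> real) set set" where
  "unoccupied W n s p = (\<Union>k<n. pieces W s p k)"

definition h_BL :: "nat \<Rightarrow> (nat \<Rightarrow> real) \<Rightarrow> (nat \<Rightarrow> real \<times> real) \<Rightarrow> real" where
  "h_BL n s p = Max (insert 0 {snd (p i) + s i | i. i < n})"

definition h_max :: "nat \<Rightarrow> (nat \<Rightarrow> real) \<Rightarrow> real" where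
  "h_max n s = Max (insert 0 {s i | i. i < n})"

definition trenches :: "real \<Rightarrow> nat \<Rightarrow> (nat \<Rightarrow> real) \<Rightarrow> (nat \<Rightarrow> real \<times> real) \<Rightarrow> (real \<times> real) set set" where
  "trenches W n s p = components
     (({0..W} \<times> {0..h_BL n s p - h_max n s})
        - ((\<Union>j<n. sqr (p j) (s j)) \<union> \<Union> (unoccupied W n s p)))"

definition right_boundary :: "real \<Rightarrow> (real \<times> real) set" where
  "right_boundary W = {W} \<times> {0..}"

definition top_trench :: "real \<Rightarrow> nat \<Rightarrow> (nat \<Rightarrow> real) \<Rightarrow> (nat \<Rightarrow> real \<times> real) \<Rightarrow> (real \<times> real) set \<Rightarrow> bool" where
  "top_trench W n s p T \<longleftrightarrow> T \<in> trenches W n s p \<and> closure T \<inter> right_boundary W = {}"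

definition adjacent_sq :: "(nat \<Rightarrow> real) \<Rightarrow> (nat \<Rightarrow> real \<times> real) \<Rightarrow> nat \<Rightarrow> (real \<times> real) set \<Rightarrow> bool" where
  "adjacent_sq s p i T \<longleftrightarrow> sqr (p i) (s i) \<inter> closure T \<noteq> {}"

end

theory Submission
  imports Defs
begin

text \<open>Removing the unoccupied pieces leaves the points whose component in the complement of the squares is
  unbounded. Such a point is never enclosed by a chain of squares resting on each other (down to
  the floor) together with a chain of left contacts (up to the left border).

  Fix a point \<open>z\<close> of the trench and follow the squares bounding the trench on the left, upwards from
  the height of \<open>z\<close> to the first square that overhangs its support towards the vertical line through
  \<open>z\<close>. By the bottom-left rule no free space below a square is large enough for that square. Hence
  either one of the bounding squares is at least as large as its distance to \<open>z\<close>, or the distance of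
  the boundary to the vertical line stays larger than the height above \<open>z\<close>; in the second case the
  overhanging square is large, and without an overhang the topmost square of the packing would fit
  into the trench. The copies used for a square \<open>S\<close> are one to its right, two below it, starting at the
  right end of its supports, and a fourth one continuing this row or lying diagonally below it.\<close>

section \<open>Finite extrema and limit points of segments\<close>

lemma finite_arg_max:
  fixes f :: "'a \<Rightarrow> real"
  assumes "finite A" "A \<noteq> {}"
  shows "\<exists>i\<in>A. \<forall>j\<in>A. f j \<le> f i"
proof -
  have "Max (f ` A) \<in> f ` A" using assms by simp
  then obtain i where "i \<in> A" "f i = Max (f ` A)" by auto
  then show ?thesis using assms(1) by (metis Max_ge finite_imageI imageI)
qed

lemma finite_arg_min:
  fixes f :: "'a \<Rightarrow> real"
  assumes "finite A" "A \<noteq> {}"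
  shows "\<exists>i\<in>A. \<forall>j\<in>A. f i \<le> f j"
  using finite_arg_max[OF assms, of "\<lambda>i. - f i"] by auto

lemma closure_horizontal:
  fixes A :: "(real \<times> real) set"
  assumes "a < b" "\<And>t. a < t \<Longrightarrow> t \<le> b \<Longrightarrow> (t, h) \<in> A"
  shows "(a, h) \<in> closure A"
  unfolding closure_approachable
proof (intro allI impI)
  fix e :: real assume "0 < e"
  then show "\<exists>w\<in>A. dist w (a, h) < e"
    using assms by (intro bexI[of _ "(min b (a + e / 2), h)"]) (auto simp: dist_Pair_Pair dist_real_def)
qed

lemma closure_vertical:
  fixes A :: "(real \<times> real) set"
  assumes "b < a" "\<And>t. b < t \<Longrightarrow> t < a \<Longrightarrow> (x, t) \<in> A"
  shows "(x, a) \<in> closure A"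
  unfolding closure_approachable
proof (intro allI impI)
  fix e :: real assume "0 < e"
  then obtain t where "max b (a - e) < t" "t < a" using assms(1) dense[of "max b (a - e)" a] by auto
  then show "\<exists>w\<in>A. dist w (x, a) < e"
    using assms(2) by (intro bexI[of _ "(x, t)"]) (auto simp: dist_Pair_Pair dist_real_def)
qed

section \<open>Squares and the bottom-left rule\<close>

locale bl_packing =
  fixes W :: real and n :: nat and s :: "nat \<Rightarrow> real" and p :: "nat \<Rightarrow> real \<times> real"
  assumes W_pos: "W > 0"
    and s_pos: "i < n \<Longrightarrow> s i > 0"
    and BL: "is_BL_packing W n s p"
begin

definition lf where "lf i = fst (p i)"
definition bt where "bt i = snd (p i)"
definition rt where "rt i = lf i + s i"
definition tp where "tp i = bt i + s i"

lemma mem_sqr: "z \<in> sqr (p i) (s i) \<longleftrightarrow> lf i \<le> fst z \<and> fst z \<le> rt i \<and> bt i \<le> snd z \<and> snd z \<le> tp i"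
  by (cases z) (auto simp: sqr_def lf_def rt_def bt_def tp_def)

lemma interior_sqr:
  "interior (sqr q a) = {fst q <..< fst q + a} \<times> {snd q <..< snd q + a}"
  by (simp add: sqr_def interior_Times)

lemma sqr_disjoint_iff:
  assumes "a > 0" "c > 0"
  shows "interior (sqr q a) \<inter> interior (sqr r c) = {} \<longleftrightarrow>
    fst q + a \<le> fst r \<or> fst r + c \<le> fst q \<or> snd q + a \<le> snd r \<or> snd r + c \<le> snd q"
proof -
  have "({l<..<l + a} \<inter> {m<..<m + c} = {}) \<longleftrightarrow> l + a \<le> m \<or> m + c \<le> l" for l m :: real
    using assms by (auto simp: min_def max_def)
  then show ?thesis
    by (simp add: interior_sqr Times_Int_Times)
qed

lemma sqr_subset_strip:
  assumes "a > 0"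
  shows "sqr q a \<subseteq> strip W \<longleftrightarrow> 0 \<le> fst q \<and> fst q + a \<le> W \<and> 0 \<le> snd q"
proof
  assume sub: "sqr q a \<subseteq> strip W"
  have "q \<in> sqr q a" "(fst q + a, snd q) \<in> sqr q a"
    using assms by (cases q; simp add: sqr_def)+
  with sub have "q \<in> strip W" "(fst q + a, snd q) \<in> strip W" by blast+
  then show "0 \<le> fst q \<and> fst q + a \<le> W \<and> 0 \<le> snd q"
    by (simp add: strip_def)
qed (auto simp: sqr_def strip_def)

lemma feasible_iff:
  assumes "i < n"
  shows "feasible W s p i q \<longleftrightarrow> 0 \<le> fst q \<and> fst q + s i \<le> W \<and> 0 \<le> snd q \<and>
    (\<forall>j<i. fst q + s i \<le> lf j \<or> rt j \<le> fst q \<or> snd q + s i \<le> bt j \<or> tp j \<le> snd q)"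
  using assms s_pos[of i] s_pos
  by (auto simp: feasible_def sqr_subset_strip sqr_disjoint_iff lf_def rt_def bt_def tp_def)

lemma feasible_pos: "i < n \<Longrightarrow> feasible W s p i (p i)"
  using BL by (auto simp: is_BL_packing_def)

lemma in_strip:
  assumes "i < n"
  shows "0 \<le> lf i" "rt i \<le> W" "0 \<le> bt i" "lf i < rt i" "bt i < tp i"
  using feasible_pos[OF assms] s_pos[OF assms]
  by (auto simp: feasible_iff[OF assms] lf_def bt_def rt_def tp_def)

lemma disjoint:
  assumes "i < n" "j < n" "i \<noteq> j"
  shows "rt i \<le> lf j \<or> rt j \<le> lf i \<or> tp i \<le> bt j \<or> tp j \<le> bt i"
proof (cases "i < j")
  case True
  then show ?thesis
    using feasible_pos[OF assms(2)] unfolding feasible_iff[OF assms(2)]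
    by (auto simp: lf_def rt_def bt_def tp_def)
next
  case False
  with assms have "j < i" by simp
  then show ?thesis
    using feasible_pos[OF assms(1)] unfolding feasible_iff[OF assms(1)]
    by (auto simp: lf_def rt_def bt_def tp_def)
qed

lemma bottom_left:
  assumes "i < n" "0 \<le> a" "a + s i \<le> W" "0 \<le> c"
    and "\<And>j. j < i \<Longrightarrow> a + s i \<le> lf j \<or> rt j \<le> a \<or> c + s i \<le> bt j \<or> tp j \<le> c"
  shows "bt i < c \<or> (bt i = c \<and> lf i \<le> a)"
proof -
  have "feasible W s p i (a, c)"
    using assms by (simp add: feasible_iff)
  with BL assms(1) show ?thesis
    by (force simp: is_BL_packing_def lf_def bt_def)
qed

text \<open>The obstruction test runs over all \<open>n\<close> squares, not only those placed
  before \<open>i\<close>, so that geometric arguments need not know the placement order.\<close>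

lemma no_lower_fit:
  assumes "i < n" "0 \<le> a" "a + s i \<le> W" "0 \<le> c" "c < bt i"
    and "\<And>j. j < n \<Longrightarrow> lf j < a + s i \<Longrightarrow> a < rt j \<Longrightarrow> bt j < c + s i \<Longrightarrow> c < tp j \<Longrightarrow> False"
  shows False
proof -
  have "a + s i \<le> lf j \<or> rt j \<le> a \<or> c + s i \<le> bt j \<or> tp j \<le> c" if "j < i" for j
    using assms(6)[of j] that assms(1) by (meson not_le order_less_trans)
  from bottom_left[OF assms(1-4) this] assms(5) show False by simp
qed

lemma near_below:
  fixes f :: "nat \<Rightarrow> real"
  assumes "y < m"
  obtains h where "y < h" "h < m" "\<And>j. j < k \<Longrightarrow> f j < m \<Longrightarrow> f j < h"
proof -
  let ?A = "insert y {f j | j. j < k \<and> f j < m}"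
  have fin: "finite ?A" by simp
  have "Max ?A < m" using assms fin by (subst Max_less_iff) auto
  then obtain h where h: "Max ?A < h" "h < m" using dense by blast
  have "a < h" if "a \<in> ?A" for a by (rule le_less_trans[OF Max_ge[OF fin that] h(1)])
  with h(2) show thesis by (intro that[of h]) auto
qed

text \<open>Lower square \<open>i\<close> to a level \<open>h\<close> just below its own. The
  bottom-left rule yields an earlier square in the way, and since no top edge lies strictly between,
  that square touches \<open>i\<close> from below.\<close>

lemma support_exists:
  assumes i: "i < n" and pos: "0 < bt i"
  obtains j where "j < i" "tp j = bt i" "lf j < rt i" "lf i < rt j"
proof -
  obtain h where h: "0 < h" "h < bt i" and hm: "\<And>j. j < n \<Longrightarrow> tp j < bt i \<Longrightarrow> tp j < h"
    using near_below[OF pos, of n tp] by blast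
  have "\<exists>j<i. \<not> (lf i + s i \<le> lf j \<or> rt j \<le> lf i \<or> h + s i \<le> bt j \<or> tp j \<le> h)"
    using bottom_left[OF i, of "lf i" h] in_strip[OF i] h by (force simp: rt_def)
  then obtain j where j: "j < i" "lf j < rt i" "lf i < rt j" "bt j < h + s i" "h < tp j"
    by (auto simp: rt_def not_le)
  have "tp j \<le> bt i"
    using disjoint[of i j] i j h by (auto simp: tp_def)
  moreover have "\<not> tp j < bt i"
    using hm[of j] j i by auto
  ultimately show thesis
    using j that by simp
qed

lemma left_contact_exists:
  assumes i: "i < n" and pos: "0 < lf i"
  obtains j where "j < i" "rt j = lf i" "bt j < tp i" "bt i < tp j"
proof -
  obtain h where h: "0 < h" "h < lf i" and hm: "\<And>j. j < n \<Longrightarrow> rt j < lf i \<Longrightarrow> rt j < h"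
    using near_below[OF pos, of n rt] by blast
  have "\<exists>j<i. \<not> (h + s i \<le> lf j \<or> rt j \<le> h \<or> bt i + s i \<le> bt j \<or> tp j \<le> bt i)"
    using bottom_left[OF i, of h "bt i"] in_strip[OF i] h by (force simp: rt_def)
  then obtain j where j: "j < i" "bt j < tp i" "bt i < tp j" "lf j < h + s i" "h < rt j"
    by (auto simp: tp_def not_le)
  have "rt j \<le> lf i"
    using disjoint[of i j] i j h by (auto simp: rt_def)
  moreover have "\<not> rt j < lf i"
    using hm[of j] j i by auto
  ultimately show thesis
    using j that by simp
qed

section \<open>Free space and its unbounded part\<close>

definition F :: "(real \<times> real) set" where
  "F = strip W - (\<Union>j<n. sqr (p j) (s j))"

definition outer :: "(real \<times> real) set" where
  "outer = {z \<in> F. \<not> bounded (connected_component_set F z)}"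

lemma F_iff:
  "z \<in> F \<longleftrightarrow> 0 \<le> fst z \<and> fst z \<le> W \<and> 0 \<le> snd z \<and>
    (\<forall>j<n. fst z < lf j \<or> rt j < fst z \<or> snd z < bt j \<or> tp j < snd z)"
  by (auto simp: F_def strip_def mem_sqr not_le)

lemma outer_F: "z \<in> outer \<Longrightarrow> z \<in> F"
  by (simp add: outer_def)

lemma outer_connected:
  assumes "connected C" "C \<subseteq> F" "z \<in> C" "z \<in> outer" "z' \<in> C"
  shows "z' \<in> outer"
proof -
  have "connected_component F z z'"
    using assms by (auto simp: connected_component_def)
  then have "connected_component_set F z = connected_component_set F z'"
    by (simp add: connected_component_eq)
  with assms show ?thesis by (auto simp: outer_def)
qed

section \<open>Chains of supports and of left contacts\<close>

text \<open>With \<open>u = fst\<close>, \<open>v = snd\<close> the sets \<open>L\<close> and \<open>M\<close> are the parts of the free space to the left and to the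
  right of a chain of squares, each resting on the next one, from square \<open>i\<close> down to the floor; with
  the coordinates exchanged they are the parts below and above a chain of left contacts from square
  \<open>i\<close> to the left border.\<close>

definition sep where
  "sep u v a c i L M \<longleftrightarrow> closed L \<and> closed M \<and> (\<exists>K. \<forall>z\<in>L. u z \<le> K) \<and> (\<forall>z\<in>L. v z \<le> c i + s i) \<and>
     (\<forall>z\<in>F. v z \<le> c i + s i \<longrightarrow> z \<in> L \<union> M) \<and> F \<inter> L \<inter> M = {} \<and> (\<forall>z\<in>M. v z \<le> c i + s i) \<and>
     (\<forall>z\<in>F. c i \<le> v z \<and> v z \<le> c i + s i \<longrightarrow> (z \<in> L \<longleftrightarrow> u z < a i) \<and> (z \<in> M \<longleftrightarrow> a i + s i < u z))"
  for u v :: "real \<times> real \<Rightarrow> real" and a c :: "nat \<Rightarrow> real" and i :: nat and L M :: "(real \<times> real) set"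

lemma sep_facts:
  assumes "sep u v a c i L M"
  shows "closed L" "closed M" "\<exists>K. \<forall>z\<in>L. u z \<le> K" "z \<in> L \<union> M \<Longrightarrow> v z \<le> c i + s i"
    "z \<in> F \<Longrightarrow> v z \<le> c i + s i \<Longrightarrow> z \<in> L \<union> M" "z \<in> F \<Longrightarrow> z \<in> L \<Longrightarrow> z \<notin> M"
    "z \<in> F \<Longrightarrow> c i \<le> v z \<Longrightarrow> v z \<le> c i + s i \<Longrightarrow> z \<in> L \<longleftrightarrow> u z < a i"
    "z \<in> F \<Longrightarrow> c i \<le> v z \<Longrightarrow> v z \<le> c i + s i \<Longrightarrow> z \<in> M \<longleftrightarrow> a i + s i < u z"
  using assms unfolding sep_def by blast+

lemma sep_base:
  assumes "continuous_on UNIV u" "continuous_on UNIV v" "c i = 0"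
    and "\<And>z. z \<in> F \<Longrightarrow> 0 \<le> v z"
    and av: "\<And>z. z \<in> F \<Longrightarrow> u z < a i \<or> a i + s i < u z \<or> v z < c i \<or> c i + s i < v z"
    and s: "0 < s i"
  shows "sep u v a c i {z. v z \<le> c i + s i \<and> u z \<le> a i} {z. v z \<le> c i + s i \<and> a i + s i \<le> u z}"
proof -
  have "closed {z. v z \<le> c i + s i \<and> u z \<le> a i}" "closed {z. v z \<le> c i + s i \<and> a i + s i \<le> u z}"
    using assms(1,2) by (auto intro!: closed_Collect_conj closed_Collect_le continuous_intros)
  then show ?thesis
    unfolding sep_def using assms(3,4) av s by fastforce
qed

text \<open>Square \<open>i\<close> prolongs the chain of \<open>j\<close> by the regions on its two
  sides.\<close>

lemma sep_step:
  assumes "continuous_on UNIV u" "continuous_on UNIV v"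
    and sj: "sep u v a c j L M"
    and ij: "c j + s j = c i" "a j < a i + s i" "a i < a j + s j"
    and av: "\<And>z. z \<in> F \<Longrightarrow> u z < a i \<or> a i + s i < u z \<or> v z < c i \<or> c i + s i < v z"
    and s: "0 < s i" "0 < s j"
  shows "sep u v a c i (L \<union> {z. c i \<le> v z \<and> v z \<le> c i + s i \<and> u z \<le> a i})
      (M \<union> {z. c i \<le> v z \<and> v z \<le> c i + s i \<and> a i + s i \<le> u z})"
proof -
  let ?L = "{z. c i \<le> v z \<and> v z \<le> c i + s i \<and> u z \<le> a i}"
  let ?M = "{z. c i \<le> v z \<and> v z \<le> c i + s i \<and> a i + s i \<le> u z}"
  have cl: "closed ?L" "closed ?M"
    using assms(1,2) by (auto intro!: closed_Collect_conj closed_Collect_le continuous_intros)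
  obtain K where K: "\<forall>z\<in>L. u z \<le> K" using sep_facts(3)[OF sj] by blast
  have vL: "v z \<le> c i" if "z \<in> L \<union> M" for z using sep_facts(4)[OF sj that] ij by simp
  have jL: "z \<in> L \<longleftrightarrow> u z < a j" "z \<in> M \<longleftrightarrow> a j + s j < u z" if "z \<in> F" "v z = c i" for z
    using sep_facts(7,8)[OF sj that(1)] that(2) ij s by auto
  \<comment> \<open>At the common level a point left of \<open>j\<close> cannot be right of
    \<open>i\<close>, since the two squares overlap there; so the old and the new description
    agree.\<close>
  have loc: "(z \<in> L \<union> ?L \<longleftrightarrow> u z < a i) \<and> (z \<in> M \<union> ?M \<longleftrightarrow> a i + s i < u z)"
    if z: "z \<in> F" "c i \<le> v z" "v z \<le> c i + s i" for z
  proof (cases "v z = c i")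
    case True
    then show ?thesis using jL[OF z(1) True] av[OF z(1)] ij z by auto
  next
    case False
    then have "z \<notin> L \<union> M" using vL[of z] z by (meson order.antisym)
    then show ?thesis using av[OF z(1)] z s by auto
  qed
  have "\<forall>z\<in>L \<union> ?L. u z \<le> max K (a i)" using K by fastforce
  then have 1: "\<exists>K. \<forall>z\<in>L \<union> ?L. u z \<le> K" by blast
  have 2: "z \<in> (L \<union> ?L) \<union> (M \<union> ?M)" if z: "z \<in> F" "v z \<le> c i + s i" for z
  proof (cases "v z \<le> c i")
    case True
    then show ?thesis using sep_facts(5)[OF sj z(1)] ij by auto
  next
    case False
    with av[OF z(1)] z have "z \<in> ?L \<or> z \<in> ?M" by auto
    then show ?thesis by blast
  qed
  have 3: "F \<inter> (L \<union> ?L) \<inter> (M \<union> ?M) = {}"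
  proof (rule ccontr)
    assume "F \<inter> (L \<union> ?L) \<inter> (M \<union> ?M) \<noteq> {}"
    then obtain z where z: "z \<in> F" "z \<in> L \<union> ?L" "z \<in> M \<union> ?M" by auto
    show False
    proof (cases "c i \<le> v z")
      case True
      with z vL[of z] s have "v z \<le> c i + s i" by auto
      from loc[OF z(1) True this] z s show False by auto
    next
      case False
      with z have "z \<in> L" "z \<in> M" by auto
      with sep_facts(6)[OF sj z(1)] show False by blast
    qed
  qed
  have "closed (L \<union> ?L)" "closed (M \<union> ?M)" using sep_facts(1,2)[OF sj] cl by (auto intro: closed_Un)
  moreover have "\<forall>z\<in>L \<union> ?L. v z \<le> c i + s i" "\<forall>z\<in>M \<union> ?M. v z \<le> c i + s i"
    using vL s by fastforce+
  ultimately show ?thesis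
    unfolding sep_def using 1 2 3 loc by blast
qed

abbreviation "sepD \<equiv> sep fst snd lf bt"
abbreviation "sepL \<equiv> sep snd fst bt lf"

lemma F_avoids:
  assumes "z \<in> F" "i < n"
  shows "fst z < lf i \<or> lf i + s i < fst z \<or> snd z < bt i \<or> bt i + s i < snd z"
  using assms by (auto simp: F_iff rt_def tp_def)

lemma sepD_step:
  assumes "i < n" "j < n" "sepD j L M" "tp j = bt i" "lf j < rt i" "lf i < rt j"
  shows "\<exists>L' M'. sepD i L' M' \<and> L \<subseteq> L'"
proof -
  have "sepD i (L \<union> {z. bt i \<le> snd z \<and> snd z \<le> bt i + s i \<and> fst z \<le> lf i})
      (M \<union> {z. bt i \<le> snd z \<and> snd z \<le> bt i + s i \<and> lf i + s i \<le> fst z})"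
    using assms s_pos F_avoids[OF _ assms(1)] by (intro sep_step[of _ _ _ _ j]) (auto simp: rt_def tp_def intro!: continuous_intros)
  then show ?thesis by blast
qed

lemma sepL_step:
  assumes "i < n" "j < n" "sepL j L M" "rt j = lf i" "bt j < tp i" "bt i < tp j"
  shows "\<exists>L' M'. sepL i L' M' \<and> L \<subseteq> L'"
proof -
  have "sepL i (L \<union> {z. lf i \<le> fst z \<and> fst z \<le> lf i + s i \<and> snd z \<le> bt i})
      (M \<union> {z. lf i \<le> fst z \<and> fst z \<le> lf i + s i \<and> bt i + s i \<le> snd z})"
    using assms s_pos F_avoids[OF _ assms(1)] by (intro sep_step[of _ _ _ _ j]) (auto simp: rt_def tp_def intro!: continuous_intros)
  then show ?thesis by blast
qed

lemma sepD_exists: "i < n \<Longrightarrow> \<exists>L M. sepD i L M"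
proof (induction i rule: less_induct)
  case (less i)
  show ?case
  proof (cases "bt i = 0")
    case True
    have "sepD i {z. snd z \<le> bt i + s i \<and> fst z \<le> lf i} {z. snd z \<le> bt i + s i \<and> lf i + s i \<le> fst z}"
      using less.prems s_pos F_avoids[OF _ less.prems] True
      by (intro sep_base) (auto simp: F_iff intro!: continuous_intros)
    then show ?thesis by blast
  next
    case False
    with in_strip(3)[OF less.prems] have "0 < bt i" by simp
    then obtain j where j: "j < i" "tp j = bt i" "lf j < rt i" "lf i < rt j"
      using support_exists[OF less.prems] by blast
    with less obtain L M where "sepD j L M" by force
    with sepD_step[of i j L M] j less.prems show ?thesis by force
  qed
qed

lemma sepL_exists: "i < n \<Longrightarrow> \<exists>L M. sepL i L M"
proof (induction i rule: less_induct)
  case (less i)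
  show ?case
  proof (cases "lf i = 0")
    case True
    have "sepL i {z. fst z \<le> lf i + s i \<and> snd z \<le> bt i} {z. fst z \<le> lf i + s i \<and> bt i + s i \<le> snd z}"
      using less.prems s_pos F_avoids[OF _ less.prems] True
      by (intro sep_base) (auto simp: F_iff intro!: continuous_intros)
    then show ?thesis by blast
  next
    case False
    with in_strip(1)[OF less.prems] have "0 < lf i" by simp
    then obtain j where j: "j < i" "rt j = lf i" "bt j < tp i" "bt i < tp j"
      using left_contact_exists[OF less.prems] by blast
    with less obtain L M where "sepL j L M" by force
    with sepL_step[of i j L M] j less.prems show ?thesis by force
  qed
qed

section \<open>Enclosure by two chains\<close>

text \<open>The chains leaving \<open>i\<close> to the floor and to the left border cut off
  \<open>G\<close> from \<open>N\<close>. On \<open>F\<close> these closed sets are disjoint and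
  cover it, and \<open>F \<inter> G\<close> is bounded; so a point of \<open>G\<close> in
  \<open>F\<close> has a bounded component.\<close>

lemma enclosed:
  assumes i: "i < n" and D: "sepD i L M" and Lc: "sepL i Bw Ab"
    and z: "z \<in> outer" "z \<in> L" "fst z < rt i \<Longrightarrow> z \<in> Bw"
  shows False
proof -
  \<comment> \<open>\<open>L\<close> only describes heights up to \<open>tp i\<close>,
    \<open>Bw\<close> only abscissas up to \<open>rt i\<close>; where just one of them applies, it
    alone decides membership in \<open>G\<close>.\<close>
  define G where "G = {z. fst z \<le> rt i \<and> z \<in> Bw \<and> tp i \<le> snd z} \<union> {z. snd z \<le> tp i \<and> z \<in> L \<and> rt i \<le> fst z}
    \<union> (Bw \<inter> L)"
  define N where "N = {z. tp i \<le> snd z \<and> rt i \<le> fst z} \<union> Ab \<union> M"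
  note D' = sep_facts[OF D, folded rt_def tp_def] and L' = sep_facts[OF Lc, folded rt_def tp_def]
  have half: "closed {z::real \<times> real. fst z \<le> rt i}" "closed {z::real \<times> real. tp i \<le> snd z}"
    "closed {z::real \<times> real. snd z \<le> tp i}" "closed {z::real \<times> real. rt i \<le> fst z}"
    by (auto intro!: closed_Collect_le continuous_intros)
  have "G = ({z. fst z \<le> rt i} \<inter> Bw \<inter> {z. tp i \<le> snd z}) \<union> ({z. snd z \<le> tp i} \<inter> L \<inter> {z. rt i \<le> fst z}) \<union> (Bw \<inter> L)"
    "N = ({z. tp i \<le> snd z} \<inter> {z. rt i \<le> fst z}) \<union> Ab \<union> M"
    by (auto simp: G_def N_def)
  then have GN: "closed G" "closed N"
    by (simp_all only:) (intro closed_Int closed_Un half D' L')+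
  note Lu = D'(4) and Bu = L'(4) and tD = D'(5) and tL = L'(5) and dD = D'(6) and dL = L'(6)
    and bD = D'(7,8) and bL = L'(7,8)
  note pos = in_strip(4,5)[OF i]
  have cover: "F \<subseteq> G \<union> N"
  proof
    fix w assume w: "w \<in> F"
    show "w \<in> G \<union> N"
    proof (cases "snd w \<le> tp i")
      case True
      note 1 = this
      show ?thesis
      proof (cases "fst w \<le> rt i")
        case True
        then show ?thesis using tD[OF w 1] tL[OF w True] by (auto simp: G_def N_def)
      next
        case False
        then show ?thesis using tD[OF w 1] 1 by (auto simp: G_def N_def)
      qed
    next
      case False
      then show ?thesis using tL[OF w] by (cases "fst w \<le> rt i") (auto simp: G_def N_def)
    qed
  qed
  have disj: "w \<notin> N" if w: "w \<in> F" "w \<in> G" for w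
  proof
    assume wN: "w \<in> N"
    have notin: "fst w < lf i \<or> rt i < fst w \<or> snd w < bt i \<or> tp i < snd w"
      using F_avoids[OF w(1) i] by (simp add: rt_def tp_def)
    from wN consider (a) "tp i \<le> snd w" "rt i \<le> fst w" | (b) "w \<in> Ab" | (c) "w \<in> M"
      unfolding N_def by blast
    note wN = this
    from w(2) consider "fst w \<le> rt i" "w \<in> Bw" "tp i \<le> snd w" | "snd w \<le> tp i" "w \<in> L" "rt i \<le> fst w" | "w \<in> Bw" "w \<in> L"
      unfolding G_def by blast
    then show False
    proof cases
      case 1
      have *: "fst w < lf i"
      proof (rule ccontr)
        assume "\<not> fst w < lf i"
        then have "snd w < bt i" using bL(1)[OF w(1)] 1 by simp
        with 1 pos show False by simp
      qed
      from wN show False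
      proof cases
        case c
        then have "snd w \<le> tp i" using Lu[of w] by simp
        with c bD(2)[OF w(1)] 1 pos * show False by simp
      qed (use * 1 pos dL[OF w(1)] in auto)
    next
      case 2
      have *: "snd w < bt i"
      proof (rule ccontr)
        assume "\<not> snd w < bt i"
        then have "fst w < lf i" using bD(1)[OF w(1)] 2 by simp
        with 2 pos show False by simp
      qed
      from wN show False
      proof cases
        case b
        then have "fst w \<le> rt i" using Bu[of w] by simp
        with b bL(2)[OF w(1)] 2 pos * show False by simp
      qed (use * 2 pos dD[OF w(1)] in auto)
    next
      case 3
      from wN show False
      proof cases
        case a
        with 3 Lu[of w] Bu[of w] notin pos show False by simp
      qed (use 3 dD[OF w(1)] dL[OF w(1)] in auto)
    qed
  qed
  obtain K1 where K1: "\<And>w. w \<in> L \<Longrightarrow> fst w \<le> K1" using D'(3) by blast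
  obtain K2 where K2: "\<And>w. w \<in> Bw \<Longrightarrow> snd w \<le> K2" using L'(3) by blast
  have "F \<inter> G \<subseteq> {0..max K1 (rt i)} \<times> {0..max K2 (tp i)}"
  proof
    fix w assume w: "w \<in> F \<inter> G"
    then have "w \<in> Bw \<or> w \<in> L" by (auto simp: G_def)
    then have "fst w \<le> max K1 (rt i)" "snd w \<le> max K2 (tp i)"
      using w K1[of w] K2[of w] Lu[of w] Bu[of w] by (auto simp: G_def)
    then show "w \<in> {0..max K1 (rt i)} \<times> {0..max K2 (tp i)}"
      using w by (cases w) (auto simp: F_iff)
  qed
  then have bd: "bounded (F \<inter> G)"
    by (rule bounded_subset[rotated]) (intro bounded_Times bounded_closed_interval)
  have zF: "z \<in> F" using z(1) by (rule outer_F)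
  have zG: "z \<in> G"
    using z(2,3) Lu[of z] by (cases "fst z < rt i") (auto simp: G_def)
  let ?C = "connected_component_set F z"
  have C: "connected ?C" "?C \<subseteq> F" "z \<in> ?C" using zF by (auto simp: connected_component_subset)
  have "?C \<inter> N = {}"
  proof (rule ccontr)
    assume "?C \<inter> N \<noteq> {}"
    moreover have "?C \<subseteq> G \<union> N" using cover C by blast
    moreover have "G \<inter> N \<inter> ?C = {}" using disj C by blast
    moreover have "G \<inter> ?C \<noteq> {}" using zG C by blast
    ultimately show False using connected_closedD[OF C(1), of G N] GN by blast
  qed
  then have "?C \<subseteq> F \<inter> G" using cover C by blast
  then have "bounded ?C" using bd by (rule bounded_subset[rotated])
  with z(1) show False by (simp add: outer_def)
qed

text \<open>\<open>z\<close> lies under \<open>S\<close> or further right, but left of the chain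
  through \<open>D\<close>: prolonged by \<open>S\<close> and joined with the left contacts of
  \<open>S\<close>, this chain encloses it.\<close>

lemma not_left_of_support_chain:
  assumes z: "z \<in> outer" and S: "S < n" and D: "D < n" "sepD D L M" "z \<in> L"
    and SD: "tp D = bt S" "lf D < rt S" "lf S < rt D"
    and zS: "lf S \<le> fst z" "snd z \<le> bt S"
  shows False
proof -
  obtain L' M' where L': "sepD S L' M'" "z \<in> L'"
    using sepD_step[OF S D(1,2) SD] D(3) by blast
  obtain Bw Ab where Bw: "sepL S Bw Ab" using sepL_exists[OF S] by blast
  have zF: "z \<in> F" using z by (rule outer_F)
  show False
  proof (rule enclosed[OF S L'(1) Bw z L'(2)])
    assume "fst z < rt S"
    then show "z \<in> Bw"
      using sep_facts(7)[OF Bw zF] zS F_avoids[OF zF S] by (auto simp: rt_def)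
  qed
qed

lemma support_left_of:
  assumes z: "z \<in> outer" and SD: "S < n" "D < n" "tp D = bt S" "lf D < rt S" "lf S < rt D"
    and "lf S \<le> fst z" "bt D \<le> snd z" "snd z \<le> tp D"
  shows "rt D < fst z"
proof (rule ccontr)
  assume "\<not> rt D < fst z"
  then have "fst z < lf D"
    using F_avoids[OF outer_F[OF z] SD(2)] assms(7-) by (auto simp: rt_def tp_def)
  obtain L M where L: "sepD D L M" using sepD_exists[OF SD(2)] by blast
  with \<open>fst z < lf D\<close> have "z \<in> L"
    using sep_facts(7)[OF L outer_F[OF z]] assms(7-) by (auto simp: tp_def)
  from not_left_of_support_chain[OF z SD(1,2) L this SD(3-5)] assms(6-) SD(3) show False by simp
qed

text \<open>Walk down the supports from \<open>i\<close> to the height of \<open>z\<close>.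
  Consecutive squares overlap horizontally, so the chain could pass to the other side of
  \<open>z\<close> only through a square excluded by \<open>avoid\<close>. The bound
  \<open>b\<close> limits \<open>avoid\<close> to squares low enough to occur in the chain.\<close>

lemma left_of_chain:
  assumes z: "z \<in> F"
    and avoid: "\<And>E. E < n \<Longrightarrow> bt E < b \<Longrightarrow> snd z \<le> tp E \<Longrightarrow> lf E \<le> fst z \<Longrightarrow> fst z \<le> rt E \<Longrightarrow> False"
  shows "i < n \<Longrightarrow> bt i < b \<Longrightarrow> snd z \<le> tp i \<Longrightarrow> fst z < lf i \<Longrightarrow> \<exists>L M. sepD i L M \<and> z \<in> L"
proof (induction i rule: less_induct)
  case (less i)
  show ?case
  proof (cases "bt i \<le> snd z")
    case True
    obtain L M where L: "sepD i L M" using sepD_exists[OF less.prems(1)] by blast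
    then have "z \<in> L" using sep_facts(7)[OF L z] True less.prems by (simp add: tp_def)
    with L show ?thesis by blast
  next
    case False
    with z have "0 < bt i" by (auto simp: F_iff)
    then obtain j where j: "j < i" "tp j = bt i" "lf j < rt i" "lf i < rt j"
      using support_exists[OF less.prems(1)] by blast
    have jn: "j < n" using j less.prems by simp
    have btj: "bt j < b" using in_strip(5)[OF jn] j less.prems by simp
    have "snd z \<le> tp j" using False j by simp
    then have "fst z < lf j" using avoid[OF jn btj] less.prems j by force
    then obtain L M where "sepD j L M" "z \<in> L"
      using less.IH[OF j(1) jn btj \<open>snd z \<le> tp j\<close>] by blast
    with sepD_step[OF less.prems(1) jn _ j(2-4)] show ?thesis by blast
  qed
qed

text \<open>Here it matters that the items are squares: a step to a left contact \<open>j\<close>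
  moves the left edge by \<open>s j\<close> and lowers the bottom by less than \<open>s j\<close>,
  so the comparison of the two distances survives until the chain is above \<open>z\<close>.\<close>

lemma below_chain:
  assumes z: "z \<in> F"
  shows "i < n \<Longrightarrow> fst z < lf i \<Longrightarrow> lf i - fst z \<le> bt i - snd z \<Longrightarrow> \<exists>L M. sepL i L M \<and> z \<in> L"
proof (induction i rule: less_induct)
  case (less i)
  have "0 < lf i" using z less.prems by (auto simp: F_iff)
  then obtain j where j: "j < i" "rt j = lf i" "bt j < tp i" "bt i < tp j"
    using left_contact_exists[OF less.prems(1)] by blast
  have jn: "j < n" using j less.prems by simp
  have "\<exists>L M. sepL j L M \<and> z \<in> L"
  proof (cases "lf j \<le> fst z")
    case True
    obtain L M where L: "sepL j L M" using sepL_exists[OF jn] by blast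
    have "snd z < bt j" using F_avoids[OF z jn] True j less.prems by (auto simp: rt_def tp_def)
    then have "z \<in> L" using sep_facts(7)[OF L z] True less.prems j by (auto simp: rt_def)
    with L show ?thesis by blast
  next
    case False
    show ?thesis
      using less.IH[OF j(1) jn] False j less.prems by (auto simp: rt_def tp_def)
  qed
  with sepL_step[OF less.prems(1) jn _ j(2-4)] show ?case by blast
qed

text \<open>Otherwise the left contacts of \<open>i\<close> pass above \<open>z\<close> and enclose
  it together with the supports on its right.\<close>

lemma slope:
  assumes z: "z \<in> outer" and i: "i < n" "sepD i L M" "z \<in> L" "fst z < lf i"
  shows "bt i - snd z < lf i - fst z"
proof (rule ccontr)
  assume "\<not> ?thesis"
  then obtain Bw Ab where "sepL i Bw Ab" "z \<in> Bw"
    using below_chain[OF outer_F[OF z] i(1,4)] by auto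
  with enclosed[OF i(1,2) _ z i(3)] show False by blast
qed

section \<open>Unoccupied pieces as bounded components\<close>

text \<open>Discarding bounded components at every stage equals discarding them once at the end:
  adding a square only shrinks components, so an unbounded one lies in unbounded ones of all earlier
  stages and loses nothing there.\<close>

lemma outer_eq: "strip W - ((\<Union>j<n. sqr (p j) (s j)) \<union> \<Union> (unoccupied W n s p)) = outer"
proof -
  define Fk where "Fk k = strip W - (\<Union>j<k. sqr (p j) (s j))" for k
  define Ek where "Ek k = strip W - ((\<Union>j<k. sqr (p j) (s j)) \<union> UP W s p k)" for k
  have "Ek k = {z \<in> Fk k. \<not> bounded (connected_component_set (Fk k) z)}" for k
  proof (induction k)
    case 0
    have "strip W = {0..W} \<times> {0..}" by (auto simp: strip_def)
    then have conn: "connected (strip W)" by (simp add: connected_Times)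
    have "\<not> bounded (strip W)"
    proof
      assume "bounded (strip W)"
      then obtain K where K: "\<And>z. z \<in> strip W \<Longrightarrow> norm z \<le> K" by (auto simp: bounded_iff)
      have "(0, \<bar>K\<bar> + 1) \<in> strip W" using W_pos by (simp add: strip_def)
      from K[OF this] show False by (simp add: norm_Pair)
    qed
    moreover have "connected_component_set (strip W) z = strip W" if "z \<in> strip W" for z
      using conn that by (simp add: connected_component_eq_self)
    ultimately show ?case by (auto simp: Ek_def Fk_def)
  next
    case (Suc k)
    define X where "X = strip W - ((\<Union>j\<le>k. sqr (p j) (s j)) \<union> UP W s p k)"
    have XE: "X = Ek k - sqr (p k) (s k)"
      by (auto simp: X_def Ek_def le_less)
    have FS: "Fk (Suc k) = Fk k - sqr (p k) (s k)"
      by (auto simp: Fk_def less_Suc_eq)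
    have "Ek (Suc k) = X - \<Union> {C \<in> components X. bounded C}"
      by (auto simp: Ek_def X_def lessThan_Suc_atMost)
    also have "\<dots> = {z \<in> X. \<not> bounded (connected_component_set X z)}"
    proof -
      have "z \<in> \<Union> {C \<in> components X. bounded C} \<longleftrightarrow> bounded (connected_component_set X z)" if "z \<in> X" for z
      proof
        assume "z \<in> \<Union> {C \<in> components X. bounded C}"
        then obtain w where "z \<in> connected_component_set X w" "bounded (connected_component_set X w)"
          by (auto simp: components_def)
        then show "bounded (connected_component_set X z)"
          using connected_component_eq[of z X w] by simp
      next
        assume "bounded (connected_component_set X z)"
        then show "z \<in> \<Union> {C \<in> components X. bounded C}"
          using that by (auto simp: components_def intro!: bexI[of _ z])
      qed
      then show ?thesis by blast
    qed
    also have "\<dots> = {z \<in> Fk (Suc k). \<not> bounded (connected_component_set (Fk (Suc k)) z)}"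
    proof (intro equalityI subsetI)
      fix z assume "z \<in> {z \<in> X. \<not> bounded (connected_component_set X z)}"
      then have z: "z \<in> X" "\<not> bounded (connected_component_set X z)" by auto
      have sub: "X \<subseteq> Fk (Suc k)" unfolding XE FS Suc.IH by auto
      then have "connected_component_set X z \<subseteq> connected_component_set (Fk (Suc k)) z"
        by (rule connected_component_mono)
      with z(2) have "\<not> bounded (connected_component_set (Fk (Suc k)) z)"
        using bounded_subset by blast
      with z(1) sub show "z \<in> {z \<in> Fk (Suc k). \<not> bounded (connected_component_set (Fk (Suc k)) z)}"
        by blast
    next
      fix z assume "z \<in> {z \<in> Fk (Suc k). \<not> bounded (connected_component_set (Fk (Suc k)) z)}"
      then have z: "z \<in> Fk (Suc k)" "\<not> bounded (connected_component_set (Fk (Suc k)) z)" by auto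
      let ?C = "connected_component_set (Fk (Suc k)) z"
      have C: "connected ?C" "?C \<subseteq> Fk (Suc k)" "z \<in> ?C"
        using z(1) by (auto simp: connected_component_subset)
      have "?C \<subseteq> X"
      proof
        fix w assume w: "w \<in> ?C"
        have "?C \<subseteq> connected_component_set (Fk k) w"
          using C w FS by (intro connected_component_maximal) auto
        with z(2) have "\<not> bounded (connected_component_set (Fk k) w)"
          using bounded_subset by blast
        moreover have "w \<in> Fk (Suc k)" using w C by blast
        ultimately show "w \<in> X" unfolding XE FS Suc.IH by blast
      qed
      then have "?C \<subseteq> connected_component_set X z"
        using C by (intro connected_component_maximal) auto
      with z(2) have "\<not> bounded (connected_component_set X z)"
        using bounded_subset by blast
      with \<open>?C \<subseteq> X\<close> C(3) show "z \<in> {z \<in> X. \<not> bounded (connected_component_set X z)}" by blast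
    qed
    finally show ?case .
  qed
  moreover have "UP W s p k = \<Union> (unoccupied W k s p)" for k
    by (induction k) (auto simp: unoccupied_def pieces_def lessThan_Suc)
  ultimately show ?thesis
    by (simp add: Ek_def Fk_def outer_def F_def)
qed


section \<open>Walls, supports and overhangs\<close>

text \<open>Squares meeting the level \<open>h\<close> reach up to \<open>m\<close>, so the wall
  seen at \<open>h\<close> is the wall just below \<open>m\<close>.\<close>

lemma near_below_edges:
  assumes "y < m"
  shows "\<exists>h. y < h \<and> h < m \<and> (\<forall>j<n. bt j < m \<longrightarrow> bt j < h) \<and> (\<forall>j<n. tp j < m \<longrightarrow> tp j < h)"
proof -
  obtain h1 where h1: "y < h1" "h1 < m" "\<And>j. j < n \<Longrightarrow> bt j < m \<Longrightarrow> bt j < h1"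
    using near_below[OF assms, of n bt] by blast
  obtain h where "h1 < h" "h < m" "\<And>j. j < n \<Longrightarrow> tp j < m \<Longrightarrow> tp j < h"
    using near_below[OF h1(2), of n tp] by blast
  with h1 show ?thesis by (intro exI[of _ h]) force
qed

definition supports where
  "supports D S \<longleftrightarrow> D < n \<and> tp D = bt S \<and> lf D < rt S \<and> lf S < rt D"

text \<open>Unspecified for squares on the floor, which have no supports.\<close>

definition rho where
  "rho S = Max (rt ` {D. supports D S})"

lemma finite_supports: "finite {D. supports D S}"
  by (rule finite_subset[of _ "{..<n}"]) (auto simp: supports_def)

lemma rho_ge: "supports D S \<Longrightarrow> rt D \<le> rho S"
  using finite_supports unfolding rho_def by (intro Max_ge) auto

lemma rho_attained:
  assumes "S < n" "0 < bt S"
  obtains D where "supports D S" "rt D = rho S"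
proof -
  obtain j where "j < S" "tp j = bt S" "lf j < rt S" "lf S < rt j"
    using support_exists[OF assms] by blast
  then have "supports j S" using assms by (simp add: supports_def)
  then have "Max (rt ` {D. supports D S}) \<in> rt ` {D. supports D S}"
    using finite_supports by (intro Max_in) auto
  then show thesis using that by (auto simp: rho_def)
qed

text \<open>The square \<open>D\<close> is a wall hiding \<open>S\<close> from the vertical line at
  \<open>x\<close>; it need not support \<open>S\<close>. A square crossing the line can be an
  overhang too.\<close>

definition overhang where
  "overhang x y S \<longleftrightarrow> S < n \<and> y < bt S \<and> lf S < x \<and>
    \<not> (\<exists>D<n. bt D < bt S \<and> bt S \<le> tp D \<and> rt S \<le> rt D \<and> rt D < x)"

end

section \<open>Trenches and the four copies\<close>

locale bl_trench = bl_packing +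
  fixes T :: "(real \<times> real) set"
  assumes top: "top_trench W n s p T"
begin

abbreviation "hm \<equiv> h_max n s"
abbreviation "H \<equiv> h_BL n s p - h_max n s"

lemma T_component: "T \<in> components (outer \<inter> {z. snd z \<le> H})"
proof -
  have "T \<in> components ({0..W} \<times> {0..H} - ((\<Union>j<n. sqr (p j) (s j)) \<union> \<Union> (unoccupied W n s p)))"
    using top by (simp add: top_trench_def trenches_def)
  also have "{0..W} \<times> {0..H} - ((\<Union>j<n. sqr (p j) (s j)) \<union> \<Union> (unoccupied W n s p))
      = outer \<inter> {z. snd z \<le> H}"
    unfolding outer_eq[symmetric] by (auto simp: strip_def)
  finally show ?thesis .
qed

lemma T_outer: "z \<in> T \<Longrightarrow> z \<in> outer" and T_le: "z \<in> T \<Longrightarrow> snd z \<le> H"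
  using in_components_subset[OF T_component] by auto

text \<open>Along \<open>C\<close> only freeness and height need checking, because membership in
  \<open>outer\<close> spreads along connected free sets.\<close>

lemma T_connected:
  assumes C: "connected C" "C \<subseteq> F" "\<And>w. w \<in> C \<Longrightarrow> snd w \<le> H" and z: "z \<in> C" "z \<in> T" and w: "w \<in> C"
  shows "w \<in> T"
proof -
  have "C \<subseteq> outer \<inter> {z. snd z \<le> H}"
    using outer_connected[OF C(1,2) z(1) T_outer[OF z(2)]] C(3) by auto
  then have "C \<subseteq> T"
    using components_maximal[OF T_component C(1)] z by blast
  with w show ?thesis by blast
qed

lemma T_vertical:
  assumes "(x, y) \<in> T" "y \<le> h" "h \<le> H" "\<And>h'. y \<le> h' \<Longrightarrow> h' \<le> h \<Longrightarrow> (x, h') \<in> F"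
  shows "(x, h) \<in> T"
proof (rule T_connected[where C = "{x} \<times> {y..h}"])
  show "connected ({x} \<times> {y..h})" by (simp add: connected_Times)
qed (use assms in auto)

lemma T_horizontal:
  assumes "(x, h) \<in> T" "\<And>x''. min x x' \<le> x'' \<Longrightarrow> x'' \<le> max x x' \<Longrightarrow> (x'', h) \<in> F"
  shows "(x', h) \<in> T"
proof (rule T_connected[where C = "{min x x'..max x x'} \<times> {h}"])
  show "connected ({min x x'..max x x'} \<times> {h})" by (simp add: connected_Times)
  show "snd w \<le> H" if "w \<in> {min x x'..max x x'} \<times> {h}" for w
    using that T_le[OF assms(1)] by auto
qed (use assms in auto)

lemma right_border_not_T: "(W, h) \<notin> T"
proof
  assume T: "(W, h) \<in> T"
  then have "0 \<le> h" using outer_F[OF T_outer] by (auto simp: F_iff)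
  then have "(W, h) \<in> right_boundary W" by (simp add: right_boundary_def)
  moreover have "closure T \<inter> right_boundary W = {}" using top by (simp add: top_trench_def)
  ultimately show False using T closure_subset by blast
qed

lemma s_le: "i < n \<Longrightarrow> s i \<le> hm"
  unfolding h_max_def by (intro Max_ge) auto

lemma n_pos: "0 < n"
proof (rule ccontr)
  assume "\<not> 0 < n"
  then have n: "\<And>j. j < n \<Longrightarrow> False" by simp
  have "T \<noteq> {}" using T_component by (rule in_components_nonempty)
  then obtain x y where z: "(x, y) \<in> T" by fastforce
  then have F: "0 \<le> x" "x \<le> W" "0 \<le> y" using outer_F[OF T_outer] by (auto simp: F_iff)
  have "(W, y) \<in> T"
    by (rule T_horizontal[OF z]) (use F n in \<open>auto simp: F_iff dest: n\<close>)
  then show False by (simp add: right_border_not_T)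
qed

lemma hm_pos: "0 < hm"
  using s_le[OF n_pos] s_pos[OF n_pos] by simp

lemma top_square:
  obtains t where "t < n" "H \<le> bt t"
proof -
  have fin: "finite (insert 0 {snd (p i) + s i |i. i < n})" by simp
  have "snd (p 0) + s 0 \<le> h_BL n s p"
    unfolding h_BL_def using n_pos by (intro Max_ge[OF fin]) auto
  with in_strip[OF n_pos] have "h_BL n s p \<noteq> 0" by (auto simp: bt_def tp_def)
  moreover have "h_BL n s p \<in> insert 0 {snd (p i) + s i |i. i < n}"
    unfolding h_BL_def by (rule Max_in[OF fin]) simp
  ultimately obtain t where "t < n" "h_BL n s p = snd (p t) + s t" by auto
  with s_le[of t] show thesis by (intro that[of t]) (auto simp: bt_def)
qed

text \<open>A witness of \<open>trouble S\<close> is a point deep below \<open>S\<close> and to the right of \<open>S\<close>'s supports,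
  connected to the bottom side of \<open>S\<close> by a free vertical and a free horizontal segment. It needs the copy
  diagonally below \<open>S\<close>; the copy furthest to the right is then dispensable, because by \<open>slope\<close>
  anything further right is separated from \<open>S\<close> by a large square.\<close>

definition trouble where
  "trouble S \<longleftrightarrow> (\<exists>u w. (u, w) \<in> T \<and> rho S + s S < u \<and> w < bt S - s S \<and>
     (\<forall>E<n. bt E < bt S \<longrightarrow> w \<le> tp E \<longrightarrow> \<not> (lf E \<le> u \<and> u \<le> rt E)) \<and>
     (\<forall>E<n. bt E < bt S \<longrightarrow> bt S \<le> tp E \<longrightarrow> rt E \<le> rho S \<or> u < lf E))"

text \<open>The offset \<open>rho S - lf S\<close> moves the left edge of \<open>S\<close> to
  \<open>rho S\<close>, the right end of its supports.\<close>

definition shifts where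
  "shifts S = {(s S, 0), (rho S - lf S, - s S), (rho S - lf S + s S, - s S),
     if trouble S then (rho S - lf S + s S, - (2 * s S)) else (rho S - lf S + 2 * s S, - s S)}"

definition covered where
  "covered z \<longleftrightarrow> (\<exists>S<n. adjacent_sq s p S T \<and> (\<exists>v\<in>shifts S. z \<in> (\<lambda>z. z + v) ` sqr (p S) (s S)))"

lemma mem_shift:
  "(x, y) \<in> (\<lambda>z. z + (a, b)) ` sqr (p S) (s S) \<longleftrightarrow>
    lf S + a \<le> x \<and> x \<le> rt S + a \<and> bt S + b \<le> y \<and> y \<le> tp S + b"
proof -
  have "(x, y) \<in> (\<lambda>z. z + (a, b)) ` sqr (p S) (s S) \<longleftrightarrow> (x - a, y - b) \<in> sqr (p S) (s S)"
    by (force simp: image_iff intro!: bexI[of _ "(x - a, y - b)"])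
  then show ?thesis by (auto simp: mem_sqr)
qed

lemma coveredI:
  assumes "S < n" "adjacent_sq s p S T" "(a, b) \<in> shifts S"
    "lf S + a \<le> x" "x \<le> rt S + a" "bt S + b \<le> y" "y \<le> tp S + b"
  shows "covered (x, y)"
  unfolding covered_def using assms mem_shift by blast

context
  fixes S assumes S: "S < n" "adjacent_sq s p S T"
begin

lemma covered_right: "rt S \<le> x \<Longrightarrow> x \<le> rt S + s S \<Longrightarrow> bt S \<le> y \<Longrightarrow> y \<le> tp S \<Longrightarrow> covered (x, y)"
  by (rule coveredI[OF S, of "s S" 0]) (auto simp: shifts_def rt_def)

lemma covered_below:
  assumes "rho S \<le> x" "x \<le> rho S + 2 * s S" "bt S - s S \<le> y" "y \<le> bt S"
  shows "covered (x, y)"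
proof (cases "x \<le> rho S + s S")
  case True
  show ?thesis
    by (rule coveredI[OF S, of "rho S - lf S" "- s S"]) (use assms True in \<open>auto simp: shifts_def rt_def tp_def\<close>)
next
  case False
  show ?thesis
    by (rule coveredI[OF S, of "rho S - lf S + s S" "- s S"]) (use assms False in \<open>auto simp: shifts_def rt_def tp_def\<close>)
qed

lemma covered_trouble:
  assumes "trouble S" "rho S + s S \<le> x" "x \<le> rho S + 2 * s S" "bt S - 2 * s S \<le> y" "y \<le> bt S - s S"
  shows "covered (x, y)"
  by (rule coveredI[OF S, of "rho S - lf S + s S" "- (2 * s S)"]) (use assms in \<open>auto simp: shifts_def rt_def tp_def\<close>)

lemma covered_far:
  assumes "\<not> trouble S" "rho S \<le> x" "x \<le> rho S + 3 * s S" "bt S - s S \<le> y" "y \<le> bt S"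
  shows "covered (x, y)"
proof (cases "x \<le> rho S + 2 * s S")
  case True
  then show ?thesis using covered_below assms by blast
next
  case False
  show ?thesis
    by (rule coveredI[OF S, of "rho S - lf S + 2 * s S" "- s S"]) (use assms False in \<open>auto simp: shifts_def rt_def tp_def\<close>)
qed

end

end

section \<open>The left boundary above a point of the trench\<close>

text \<open>In use, \<open>hs\<close> is the bottom of the lowest overhang, or \<open>H\<close> if
  no overhang starts at or below \<open>H\<close>. Excluding vertical edges at \<open>x\<close>
  makes comparisons with \<open>x\<close> strict; a limit argument lifts this restriction
  later.\<close>

locale column = bl_trench +
  fixes x y hs :: real
  assumes inT: "(x, y) \<in> T"
    and gen: "\<And>j. j < n \<Longrightarrow> lf j \<noteq> x \<and> rt j \<noteq> x"
    and low: "\<And>S. overhang x y S \<Longrightarrow> hs \<le> bt S"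
    and hs_le: "hs \<le> H"
begin

lemma base: "0 \<le> x" "x \<le> W" "0 \<le> y" "(x, y) \<in> F"
  using outer_F[OF T_outer[OF inT]] by (auto simp: F_iff)

text \<open>Below \<open>hs\<close> nothing overhangs, so each square above \<open>y\<close> is
  hidden by a lower one reaching at least as far towards \<open>x\<close>; descending through these
  leads to level \<open>h\<close>. Upwards the left boundary thus only recedes.\<close>

lemma recede:
  "S < n \<Longrightarrow> lf S < x \<Longrightarrow> bt S < hs \<Longrightarrow> y \<le> h \<Longrightarrow> h \<le> tp S \<Longrightarrow>
    \<exists>D<n. bt D \<le> h \<and> h \<le> tp D \<and> rt S \<le> rt D \<and> rt D < x"
proof (induction S rule: measure_induct_rule[where f = "\<lambda>S. card {j. j < n \<and> bt j < bt S}"])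
  case (less S)
  note S = less.prems
  have wall: "\<exists>D<n. bt D < bt S \<and> bt S \<le> tp D \<and> rt S \<le> rt D \<and> rt D < x" if "y < bt S"
    using low[of S] S that by (auto simp: overhang_def)
  show ?case
  proof (cases "bt S \<le> h")
    case True
    have "rt S < x"
    proof (cases "bt S \<le> y")
      case True
      then show ?thesis using F_avoids[OF base(4) S(1)] S by (auto simp: rt_def tp_def)
    next
      case False
      then show ?thesis using wall by auto
    qed
    then show ?thesis using True S by auto
  next
    case False
    then obtain D where D: "D < n" "bt D < bt S" "bt S \<le> tp D" "rt S \<le> rt D" "rt D < x"
      using wall S by auto
    have "card {j. j < n \<and> bt j < bt D} < card {j. j < n \<and> bt j < bt S}"
      using D by (intro psubset_card_mono) auto
    then have "\<exists>D'<n. bt D' \<le> h \<and> h \<le> tp D' \<and> rt D \<le> rt D' \<and> rt D' < x"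
      using D S False in_strip(4)[OF D(1)] by (intro less.IH) auto
    then show ?thesis using D(4) by force
  qed
qed

lemma no_straddle:
  assumes "S < n" "lf S \<le> x" "bt S < hs" "y \<le> tp S"
  shows "rt S < x"
  using recede[of S y] assms gen[of S] by force

lemma free_vertical:
  assumes "y \<le> h" "h < hs"
  shows "(x, h) \<in> T"
proof (rule T_vertical[OF inT])
  fix h' assume h': "y \<le> h'" "h' \<le> h"
  have "x < lf j \<or> rt j < x \<or> h' < bt j \<or> tp j < h'" if "j < n" for j
    using no_straddle[OF that] h' assms by force
  then show "(x, h') \<in> F" using base h' by (auto simp: F_iff)
qed (use assms hs_le in auto)

lemma free_slice:
  assumes h: "y \<le> h" "h < hs" and x': "0 \<le> x'" "x' \<le> x"
    and right: "\<And>D. D < n \<Longrightarrow> bt D \<le> h \<Longrightarrow> h \<le> tp D \<Longrightarrow> rt D < x \<Longrightarrow> rt D < x'"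
  shows "(x', h) \<in> T"
proof (rule T_horizontal[OF free_vertical[OF h]])
  fix x'' assume "min x x' \<le> x''" "x'' \<le> max x x'"
  then have x'': "x' \<le> x''" "x'' \<le> x" using x' by auto
  have "x'' < lf j \<or> rt j < x'' \<or> h < bt j \<or> tp j < h" if "j < n" for j
    using no_straddle[OF that] right[OF that] h x'' by force
  then show "(x'', h) \<in> F" using base h x' x'' by (auto simp: F_iff)
qed

lemma support_left:
  assumes S: "S < n" "lf S < x" "y < bt S" "bt S \<le> hs" and D: "supports D S"
  shows "rt D < x"
proof -
  have D': "D < n" "tp D = bt S" "lf D < rt S" "lf S < rt D" using D by (auto simp: supports_def)
  \<comment> \<open>A height at which the vertical line is free and \<open>D\<close> is
    present.\<close>
  let ?q = "max y (bt D)"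
  have "bt D < bt S" using in_strip(5)[OF D'(1)] D' by simp
  then have "(x, ?q) \<in> outer" using S by (intro T_outer free_vertical) auto
  from support_left_of[OF this S(1) D'] show ?thesis using S D' \<open>bt D < bt S\<close> by simp
qed

text \<open>The right edge is placed at \<open>x\<close>. Only the wall at level \<open>q\<close>
  needs checking, since by \<open>recede\<close> anything intruding higher up is hidden by a square
  at level \<open>q\<close> reaching at least as far.\<close>

lemma column_no_fit:
  assumes i: "i < n" "y \<le> q" "q < bt i" "q + s i \<le> hs" "s i \<le> x"
    and right: "\<And>D. D < n \<Longrightarrow> bt D \<le> q \<Longrightarrow> q \<le> tp D \<Longrightarrow> rt D < x \<Longrightarrow> rt D \<le> x - s i"
  shows False
proof (rule no_lower_fit[OF i(1), of "x - s i" q])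
  fix j assume j: "j < n" "lf j < x - s i + s i" "x - s i < rt j" "bt j < q + s i" "q < tp j"
  then obtain D where "D < n" "bt D \<le> q" "q \<le> tp D" "rt j \<le> rt D" "rt D < x"
    using recede[of j q] i by auto
  with right[of D] j show False by simp
qed (use i base in auto)

lemma widest_wall:
  assumes "\<exists>D<n. bt D \<le> h \<and> h \<le> tp D \<and> rt D < x"
  shows "\<exists>i<n. bt i \<le> h \<and> h \<le> tp i \<and> rt i < x \<and>
    (\<forall>D<n. bt D \<le> h \<longrightarrow> h \<le> tp D \<longrightarrow> rt D < x \<longrightarrow> rt D \<le> rt i)"
  using finite_arg_max[of "{D. D < n \<and> bt D \<le> h \<and> h \<le> tp D \<and> rt D < x}" rt] assms by auto


text \<open>The free segment between the widest square at level \<open>h\<close> and the vertical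
  line lies in \<open>T\<close>, and its left end belongs to that square.\<close>

lemma adjacent_left:
  assumes i: "i < n" "bt i \<le> h" "h \<le> tp i" "rt i < x" and h: "y \<le> h" "h < hs"
    and widest: "\<And>D. D < n \<Longrightarrow> bt D \<le> h \<Longrightarrow> h \<le> tp D \<Longrightarrow> rt D < x \<Longrightarrow> rt D \<le> rt i"
  shows "adjacent_sq s p i T"
proof -
  have "(x', h) \<in> T" if "rt i < x'" "x' \<le> x" for x'
  proof (rule free_slice[OF h])
    show "0 \<le> x'" using in_strip[OF i(1)] that by simp
  qed (use widest that in force)+
  then have "(rt i, h) \<in> closure T" by (rule closure_horizontal[OF i(4)])
  moreover have "(rt i, h) \<in> sqr (p i) (s i)" using i in_strip[OF i(1)] by (simp add: mem_sqr)
  ultimately show ?thesis unfolding adjacent_sq_def by auto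
qed

text \<open>Among the squares violating the claim take the one reaching furthest to the right, and the lowest
  of these: it is adjacent to \<open>T\<close>, and comparing it with the wall just below its bottom shows that it
  is large enough for one of its copies to cover \<open>(x, y)\<close>.\<close>

lemma profile:
  assumes unc: "\<not> covered (x, y)"
    and \<mu>: "\<mu> \<le> hs" "(\<exists>C. overhang x y C \<and> bt C = hs \<and> \<mu> = hs) \<or> \<mu> + hm \<le> hs"
    and S: "S < n" "rt S < x" "bt S < \<mu>" "y \<le> tp S"
  shows "min (tp S) \<mu> - y \<le> x - rt S"
proof (rule ccontr)
  assume neg: "\<not> ?thesis"
  define bad where "bad S \<longleftrightarrow> S < n \<and> rt S < x \<and> bt S < \<mu> \<and> y \<le> tp S \<and> x - rt S < min (tp S) \<mu> - y" for S
  have fin: "finite {S. bad S}" by (rule finite_subset[of _ "{..<n}"]) (auto simp: bad_def)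
  have "bad S" using neg S by (auto simp: bad_def)
  then obtain B0 where B0: "bad B0" "\<And>D. bad D \<Longrightarrow> rt D \<le> rt B0"
    using finite_arg_max[OF fin, of rt] by auto
  have "finite {S. bad S \<and> rt S = rt B0}" using fin by (rule rev_finite_subset) auto
  then obtain B where B: "bad B" "rt B = rt B0" and m2: "\<And>D. bad D \<Longrightarrow> rt D = rt B0 \<Longrightarrow> bt B \<le> bt D"
    using finite_arg_min[of "{S. bad S \<and> rt S = rt B0}" bt] B0(1) by auto
  have m1: "rt D \<le> rt B" if "bad D" for D using B0(2)[OF that] B(2) by simp
  have m2: "bt B \<le> bt D" if "bad D" "rt D = rt B" for D using m2 that B(2) by simp
  have Bn: "B < n" and Bx: "rt B < x" and B\<mu>: "bt B < \<mu>" and By: "y \<le> tp B"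
    and Bbad: "x - rt B < min (tp B) \<mu> - y" using B(1) by (auto simp: bad_def)
  note Bpos = in_strip[OF Bn]
  let ?m = "min (tp B) \<mu>"
  have ym: "max (bt B) y < ?m" using Bbad Bx B\<mu> Bpos by auto
  obtain h where h: "max (bt B) y < h" "h < ?m" "\<And>j. j < n \<Longrightarrow> tp j < ?m \<Longrightarrow> tp j < h"
    using near_below_edges[OF ym] by blast
  have adj: "adjacent_sq s p B T"
  proof (rule adjacent_left[OF Bn])
    fix D assume D: "D < n" "bt D \<le> h" "h \<le> tp D" "rt D < x"
    have "?m \<le> tp D" using h(3)[OF D(1)] D by force
    show "rt D \<le> rt B"
    proof (rule ccontr)
      assume "\<not> rt D \<le> rt B"
      then have "bad D" using D \<open>?m \<le> tp D\<close> h Bbad by (auto simp: bad_def)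
      with m1 \<open>\<not> rt D \<le> rt B\<close> show False by blast
    qed
  qed (use h Bx \<mu> in auto)
  \<comment> \<open>For \<open>y\<close> in the height range of \<open>B\<close>, badness leaves a
    distance below \<open>s B\<close>, within the right copy.\<close>
  have yB: "y < bt B"
  proof (rule ccontr)
    assume "\<not> y < bt B"
    then have "covered (x, y)"
      using covered_right[OF Bn adj, of x y] Bx By Bbad by (auto simp: tp_def)
    with unc show False by simp
  qed
  \<comment> \<open>If \<open>B\<close> rose above an overhang at level \<open>hs\<close>, the
    overhang would start right of \<open>B\<close> and its support would be a bad square further
    right.\<close>
  have Bhs: "tp B \<le> hs"
  proof (rule ccontr)
    assume neg: "\<not> tp B \<le> hs"
    show False
      using \<mu>(2)
    proof
      assume "\<exists>C. overhang x y C \<and> bt C = hs \<and> \<mu> = hs"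
      then obtain C where C: "overhang x y C" "bt C = hs" "\<mu> = hs" by blast
      have Cn: "C < n" "y < bt C" "lf C < x" using C by (auto simp: overhang_def)
      have "\<not> rt C \<le> rt B"
        using C(1) Bn Bx B\<mu> C(2,3) neg by (auto simp: overhang_def)
      then have BC: "rt B \<le> lf C"
        using disjoint[OF Cn(1) Bn] C neg Bpos in_strip[OF Cn(1)] B\<mu> by force
      obtain D where D: "supports D C"
        using rho_attained[OF Cn(1)] Cn base(3) by auto
      have "rt D < x" by (rule support_left[OF Cn(1,3,2)]) (use C D in auto)
      then have "bad D" "rt B < rt D"
        using D C BC Bbad in_strip[of D] Cn neg by (auto simp: bad_def supports_def)
      with m1 show False by force
    next
      assume "\<mu> + hm \<le> hs"
      then show False using s_le[OF Bn] neg B\<mu> by (simp add: tp_def)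
    qed
  qed
  have "\<not> overhang x y B" using low[of B] Bpos(5) Bhs by linarith
  moreover have Blx: "lf B < x" using Bpos(4) Bx by linarith
  ultimately obtain D where D: "D < n" "bt D < bt B" "bt B \<le> tp D" "rt B \<le> rt D" "rt D < x"
    unfolding overhang_def using Bn yB by blast
  obtain q where q: "y < q" "q < bt B" "\<And>j. j < n \<Longrightarrow> bt j < bt B \<Longrightarrow> bt j < q"
      "\<And>j. j < n \<Longrightarrow> tp j < bt B \<Longrightarrow> tp j < q"
    using near_below_edges[OF yB] by blast
  have Dq: "bt D \<le> q" "q \<le> tp D" using q(3)[OF D(1,2)] D(3) q(2) by linarith+
  then obtain i where i: "i < n" "bt i \<le> q" "q \<le> tp i" "rt i < x"
    "\<And>D. D < n \<Longrightarrow> bt D \<le> q \<Longrightarrow> q \<le> tp D \<Longrightarrow> rt D < x \<Longrightarrow> rt D \<le> rt i"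
    using widest_wall[of q] D(1,5) by blast
  have iB: "rt B \<le> rt i" using i(5)[OF D(1) Dq D(5)] D(4) by linarith
  have ti: "bt B \<le> tp i" using q(4)[OF i(1)] i(3) by linarith
  \<comment> \<open>\<open>i\<close> reaches at least as far right as \<open>B\<close> but starts
    lower, against the choice of \<open>B\<close>.\<close>
  have "\<not> bad i" using m1[of i] m2[of i] iB i q by auto
  then have gi: "bt B - y \<le> x - rt i"
    using i q B\<mu> ti by (auto simp: bad_def)
  have sB: "x - rt i < s B"
  proof (rule ccontr)
    assume neg: "\<not> x - rt i < s B"
    show False
    proof (rule column_no_fit[OF Bn _ q(2)])
      show "rt D \<le> x - s B" if "D < n" "bt D \<le> q" "q \<le> tp D" "rt D < x" for D
        using i(5)[OF that] neg by simp
      show "s B \<le> x" using neg in_strip[OF i(1)] by simp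
    qed (use q Bhs in \<open>auto simp: tp_def\<close>)
  qed
  obtain R where R: "supports R B" "rt R = rho B"
    using rho_attained[OF Bn] yB base(3) by auto
  have rho: "rho B < x" "lf B < rho B"
    using support_left[OF Bn Blx yB _ R(1)] Bpos Bhs R by (auto simp: supports_def)
  \<comment> \<open>By \<open>gi\<close> and \<open>sB\<close> the point is less than
    \<open>s B\<close> below the bottom of \<open>B\<close>, so only its abscissa can keep it out of
    the two copies there.\<close>
  have far: "rho B + 2 * s B < x"
    using covered_below[OF Bn adj, of x y] unc rho gi sB yB by (auto simp flip: not_le)
  have "x \<le> rho B + 3 * s B"
    using rho Bbad gi sB by (auto simp: tp_def rt_def)
  \<comment> \<open>Three copies in a row would reach \<open>x\<close>, so the fourth copy must be
    the diagonal one, and a witness exists.\<close>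
  then have "trouble B"
    using covered_far[OF Bn adj, of x y] unc rho gi sB yB by auto
  then obtain u w where u: "(u, w) \<in> T" "rho B + s B < u" "w < bt B - s B"
    and avoid: "\<And>E. E < n \<Longrightarrow> bt E < bt B \<Longrightarrow> w \<le> tp E \<Longrightarrow> lf E \<le> u \<Longrightarrow> u \<le> rt E \<Longrightarrow> False"
    and side: "\<And>E. E < n \<Longrightarrow> bt E < bt B \<Longrightarrow> bt B \<le> tp E \<Longrightarrow> rt E \<le> rho B \<or> u < lf E"
    unfolding trouble_def by blast
  have biB: "bt i < bt B" using i q by simp
  have ui: "u < lf i" using side[OF i(1) biB ti] far sB s_pos[OF Bn] by auto
  \<comment> \<open>\<open>i\<close> ends more than \<open>s B\<close> to the right of the witness:
    it is large itself or, by \<open>slope\<close>, starts far from \<open>u\<close>.\<close>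
  have "s B < s i + (lf i - u)"
  proof (cases "bt i \<le> w")
    case True
    then show ?thesis using u ti ui by (auto simp: tp_def)
  next
    case False
    have "w \<le> tp i" using False in_strip[OF i(1)] by simp
    then obtain L M where LM: "sepD i L M" "(u, w) \<in> L"
      using left_of_chain[of "(u, w)" "bt B" i] outer_F[OF T_outer[OF u(1)]] avoid biB ui i(1) by auto
    from slope[OF T_outer[OF u(1)] i(1) LM] ui have "bt i - w < lf i - u" by simp
    then show ?thesis using u ti by (auto simp: tp_def)
  qed
  \<comment> \<open>Now \<open>rt i\<close> exceeds \<open>rho B + 2 * s B\<close>, and
    \<open>gi\<close> puts \<open>x\<close> beyond what \<open>Bbad\<close> allows.\<close>
  then show False
    using Bbad gi u rho by (auto simp: rt_def tp_def)
qed

section \<open>Columns without an overhang\<close>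

text \<open>Without a wall, the row just below \<open>H\<close> is free from the left border to a
  square \<open>r\<close> right of \<open>x\<close>; with no such \<open>r\<close> the trench would
  touch the right border. By \<open>slope\<close> and the depth of \<open>y\<close>,
  \<open>r\<close> is so far right that the topmost square would fit on its left.\<close>

lemma wall_exists:
  assumes "hs = H" "y \<le> H - 2 * hm" and h: "y \<le> h" "h < H"
  shows "\<exists>D<n. bt D \<le> h \<and> h \<le> tp D \<and> rt D < x"
proof (rule ccontr)
  assume neg: "\<not> ?thesis"
  obtain q where q: "h < q" "q < H" "\<And>j. j < n \<Longrightarrow> bt j < H \<Longrightarrow> bt j < q"
      "\<And>j. j < n \<Longrightarrow> tp j < H \<Longrightarrow> tp j < q"
    using near_below_edges[OF h(2)] by blast
  have none: "x < lf D" if D: "D < n" "bt D \<le> q" "q \<le> tp D" for D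
  proof (rule ccontr)
    assume "\<not> x < lf D"
    then have "lf D < x" using gen[OF D(1)] by force
    with recede[OF D(1), of h] D q h assms(1) neg show False by force
  qed
  have zq: "(x, q) \<in> T" using q h assms(1) by (intro free_vertical) auto
  let ?A = "{D. D < n \<and> bt D \<le> q \<and> q \<le> tp D}"
  have "?A \<noteq> {}"
  proof
    assume A: "?A = {}"
    then have free: "q < bt j \<or> tp j < q" if "j < n" for j using that not_le by blast
    have "(W, q) \<in> T"
    proof (rule T_horizontal[OF zq])
      fix x'' assume "min x W \<le> x''" "x'' \<le> max x W"
      then have "0 \<le> x''" "x'' \<le> W" "0 \<le> q" using base q h by auto
      then show "(x'', q) \<in> F" using free by (simp add: F_iff)
    qed
    then show False by (simp add: right_border_not_T)
  qed
  moreover have "finite ?A" by simp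
  ultimately obtain r where "r \<in> ?A" and r': "\<And>D. D \<in> ?A \<Longrightarrow> lf r \<le> lf D"
    using finite_arg_min[of ?A lf] by blast
  then have r: "r < n" "bt r \<le> q" "q \<le> tp r"
    and r_min: "\<And>D. D < n \<Longrightarrow> bt D \<le> q \<Longrightarrow> q \<le> tp D \<Longrightarrow> lf r \<le> lf D" by auto
  have xr: "x < lf r" using none r by blast
  have slice: "(x', q) \<in> T" if "x \<le> x'" "x' < lf r" for x'
  proof (rule T_horizontal[OF zq])
    fix x'' assume "min x x' \<le> x''" "x'' \<le> max x x'"
    then have x'': "x \<le> x''" "x'' < lf r" using that by auto
    have "x'' < lf j \<or> rt j < x'' \<or> q < bt j \<or> tp j < q" if "j < n" for j
      using r_min[OF that] x'' by force
    moreover have "0 \<le> x''" "x'' \<le> W" "0 \<le> q" using x'' base q h in_strip[OF r(1)] by auto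
    ultimately show "(x'', q) \<in> F" by (simp add: F_iff)
  qed
  have top_r: "H \<le> tp r" using q(4)[OF r(1)] r by force
  have low_r: "bt r - y < lf r - x"
  proof (cases "bt r \<le> y")
    case False
    have "\<exists>L M. sepD r L M \<and> (x, y) \<in> L"
    proof (rule left_of_chain[where b = H])
      show "False" if "E < n" "bt E < H" "snd (x, y) \<le> tp E" "lf E \<le> fst (x, y)" "fst (x, y) \<le> rt E" for E
        using no_straddle[OF that(1)] that assms(1) by auto
    qed (use base r q xr h in auto)
    then show ?thesis using slope[OF T_outer[OF inT] r(1)] xr by auto
  qed (use xr in auto)
  obtain t where t: "t < n" "H \<le> bt t" by (rule top_square)
  have "lf r < s t"
  proof (rule ccontr)
    assume fits: "\<not> lf r < s t"
    \<comment> \<open>The lowest square above the row starting left of \<open>r\<close> would have a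
      support not starting left of \<open>r\<close>, and so would enclose a point of the
      row.\<close>
    have none_above: "lf r \<le> lf S" if S: "S < n" "q < bt S" for S
    proof (rule ccontr)
      let ?K = "{S. S < n \<and> q < bt S \<and> lf S < lf r}"
      assume "\<not> lf r \<le> lf S"
      then have "?K \<noteq> {}" "finite ?K" using S by auto
      then obtain S where "S \<in> ?K" and K: "\<And>E. E \<in> ?K \<Longrightarrow> bt S \<le> bt E"
        using finite_arg_min[of ?K bt] by blast
      then have S: "S < n" "q < bt S" "lf S < lf r" by auto
      have K: "lf r \<le> lf E" if "E < n" "q \<le> tp E" "bt E < bt S" for E
        using K[of E] r_min[of E] that by force
      have "0 < bt S" using S q h base by simp
      then obtain D where "supports D S" using rho_attained[OF S(1)] by blast
      then have D: "D < n" "tp D = bt S" "lf D < rt S" "lf S < rt D" by (simp_all add: supports_def)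
      have rD: "lf r \<le> lf D" using K[OF D(1)] D S in_strip[OF D(1)] by simp
      let ?z = "(max x (lf S), q)"
      have z: "?z \<in> outer" using slice[of "max x (lf S)"] xr S T_outer by auto
      have "\<exists>L M. sepD D L M \<and> ?z \<in> L"
      proof (rule left_of_chain[where b = "bt S"])
        show "False" if "E < n" "bt E < bt S" "snd ?z \<le> tp E" "lf E \<le> fst ?z" "fst ?z \<le> rt E" for E
          using K[OF that(1)] that xr S by auto
      qed (use outer_F[OF z] D S rD xr in_strip[OF D(1)] in auto)
      then show False
        using not_left_of_support_chain[OF z S(1) D(1) _ _ D(2-4)] S by auto
    qed
    show False
    proof (rule no_lower_fit[OF t(1), of 0 q])
      show "False" if "j < n" "lf j < 0 + s t" "0 < rt j" "bt j < q + s t" "q < tp j" for j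
        using none_above[OF that(1)] r_min[OF that(1)] that fits by force
      show "0 + s t \<le> W" using fits in_strip[OF r(1)] by simp
    qed (use q t h base in auto)
  qed
  then have "lf r < hm" using s_le[OF t(1)] by simp
  moreover have "H - bt r \<le> hm" using top_r s_le[OF r(1)] by (simp add: tp_def)
  ultimately show False using low_r assms(2) base(1) hm_pos by simp
qed

text \<open>By \<open>profile\<close> every wall just below \<open>H - hm\<close> keeps distance
  \<open>hm\<close> from the vertical line, so the topmost square would fit there.\<close>

lemma not_open_to_top:
  assumes hsH: "hs = H" and y: "y \<le> H - 2 * hm" and unc: "\<not> covered (x, y)"
  shows False
proof -
  let ?\<mu> = "H - hm"
  have "y < ?\<mu>" using y hm_pos by simp
  then obtain q where q: "y < q" "q < ?\<mu>" and qb: "\<forall>j<n. bt j < ?\<mu> \<longrightarrow> bt j < q" and qt: "\<forall>j<n. tp j < ?\<mu> \<longrightarrow> tp j < q"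
    using near_below_edges[of y ?\<mu>] by blast
  have wall: "rt D \<le> x - hm" if D: "D < n" "bt D \<le> q" "q \<le> tp D" "rt D < x" for D
  proof -
    have "?\<mu> \<le> tp D" using qt D by (meson not_le)
    moreover have "min (tp D) ?\<mu> - y \<le> x - rt D"
      by (rule profile[OF unc]) (use D q hsH hm_pos in auto)
    ultimately show ?thesis using y by simp
  qed
  obtain t where t: "t < n" "H \<le> bt t" by (rule top_square)
  obtain D where D: "D < n" "bt D \<le> q" "q \<le> tp D" "rt D < x"
    using wall_exists[OF hsH y, of q] q hm_pos by auto
  show False
  proof (rule column_no_fit[OF t(1), of q])
    show "s t \<le> x" using wall[OF D] s_le[OF t(1)] in_strip[OF D(1)] by simp
    show "rt D \<le> x - s t" if "D < n" "bt D \<le> q" "q \<le> tp D" "rt D < x" for D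
      using wall[OF that] s_le[OF t(1)] by simp
    show "q + s t \<le> hs" using q hsH s_le[OF t(1)] by simp
  qed (use q t hm_pos in auto)
qed

section \<open>The lowest overhang\<close>

context
  fixes C q
  assumes C: "overhang x y C" "bt C = hs"
    and q: "y < q" "q < hs" and qb: "\<And>j. j < n \<Longrightarrow> bt j < hs \<Longrightarrow> bt j < q"
    and qt: "\<And>j. j < n \<Longrightarrow> tp j < hs \<Longrightarrow> tp j < q"
begin

lemma C_facts: "C < n" "y < bt C" "lf C < x" "0 < bt C"
  using C base by (auto simp: overhang_def)

text \<open>The widest wall just below \<open>hs\<close> reaches \<open>hs\<close> but cannot hide
  the overhang \<open>C\<close>; so it ends underneath \<open>C\<close>, supports it and determines
  \<open>rho C\<close>.\<close>

lemma overhang_wall: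
  obtains i where "i < n" "bt i < hs" "hs \<le> tp i" "rt i < x" "rt i = rho C" "rt i < rt C" "lf C < rt i"
    "\<And>D. D < n \<Longrightarrow> bt D < hs \<Longrightarrow> q \<le> tp D \<Longrightarrow> rt D < x \<Longrightarrow> rt D \<le> rho C"
proof -
  obtain D where D: "supports D C" "rt D = rho C" using rho_attained C_facts by blast
  then have D': "D < n" "tp D = hs" "lf D < rt C" "lf C < rt D" using C by (auto simp: supports_def)
  have "rt D < x" using support_left[OF C_facts(1,3,2) _ D(1)] C by simp
  moreover have btD: "bt D < hs" using in_strip(5)[OF D'(1)] D' by simp
  moreover have "bt D \<le> q" using qb[OF D'(1) btD] by simp
  moreover have "q \<le> tp D" using D' q by simp
  ultimately obtain i where i: "i < n" "bt i \<le> q" "q \<le> tp i" "rt i < x"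
    "\<And>D. D < n \<Longrightarrow> bt D \<le> q \<Longrightarrow> q \<le> tp D \<Longrightarrow> rt D < x \<Longrightarrow> rt D \<le> rt i"
    using widest_wall[of q] D'(1) by blast
  have Di: "rt D \<le> rt i" using i(5) D' \<open>rt D < x\<close> \<open>bt D \<le> q\<close> \<open>q \<le> tp D\<close> by blast
  have ti: "hs \<le> tp i" using qt[OF i(1)] i(3) by linarith
  have bi: "bt i < hs" using i q by simp
  have "\<not> rt C \<le> rt i"
    using C(1) i ti bi C(2) unfolding overhang_def by blast
  then have iC: "rt i < rt C" by simp
  then have "i \<noteq> C" by auto
  have "tp i \<le> bt C"
    using disjoint[OF i(1) C_facts(1) \<open>i \<noteq> C\<close>] iC Di D' C(2) bi in_strip[OF i(1)] in_strip[OF C_facts(1)]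
    by linarith
  then have "supports i C"
    using i ti C(2) iC Di D' in_strip[OF i(1)] by (auto simp: supports_def)
  then have "rt i = rho C" using rho_ge[of i C] Di D(2) by simp
  moreover have "rt E \<le> rho C" if "E < n" "bt E < hs" "q \<le> tp E" "rt E < x" for E
    using i(5)[OF that(1) _ that(3,4)] qb[OF that(1,2)] \<open>rt i = rho C\<close> by simp
  ultimately show thesis
    using that[of i] i bi ti iC Di D' by simp
qed

text \<open>If \<open>C\<close> ended at distance at least its side length to the left of \<open>x\<close>, it would fit just below its own
  level next to the vertical line through \<open>x\<close>: a square obstructing this from above would have a
  support chain passing that line on the right.\<close>

lemma overhang_reach: "x - rho C < 2 * s C"
proof -
  obtain i where i: "i < n" "rt i = rho C" "rt i < rt C" "lf C < rt i"
    and wall: "\<And>D. D < n \<Longrightarrow> bt D < hs \<Longrightarrow> q \<le> tp D \<Longrightarrow> rt D < x \<Longrightarrow> rt D \<le> rho C"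
    by (rule overhang_wall) blast
  note Cn = C_facts(1)
  note Cpos = in_strip[OF Cn]
  have left: "rt E \<le> rho C" if "E < n" "lf E < x" "bt E < hs" "q \<le> tp E" for E
    using wall[OF that(1,3,4)] no_straddle[OF that(1) _ that(3)] that q by auto
  have "x - rt C < s C"
  proof (rule ccontr)
    assume neg: "\<not> x - rt C < s C"
    have Cx: "rt C < x" using neg s_pos[OF Cn] by simp
    let ?K = "{S. S < n \<and> hs \<le> bt S \<and> bt S < tp C \<and> rt C \<le> lf S \<and> lf S < x}"
    have none: "?K = {}"
    proof (rule ccontr)
      assume "?K \<noteq> {}"
      moreover have "finite ?K" by simp
      ultimately obtain S where "S \<in> ?K" and K: "\<And>E. E \<in> ?K \<Longrightarrow> bt S \<le> bt E"
        using finite_arg_min[of ?K bt] by blast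
      then have S: "S < n" "hs \<le> bt S" "bt S < tp C" "rt C \<le> lf S" "lf S < x" by auto
      have "0 < bt S" using S C C_facts by simp
      then obtain D where "supports D S" using rho_attained[OF S(1)] by blast
      then have D: "D < n" "tp D = bt S" "lf D < rt S" "lf S < rt D" by (simp_all add: supports_def)
      have btD: "bt D < bt S" using in_strip(5)[OF D(1)] D by simp
      \<comment> \<open>A lower square starting left of the line would belong to \<open>?K\<close>
        or end by \<open>rho C\<close>; hence the support chain of \<open>S\<close> passes on the
        right.\<close>
      have right: "x < lf E" if E: "E < n" "bt E < bt S" "q \<le> tp E" "rt C < rt E" for E
      proof (rule ccontr)
        assume "\<not> x < lf E"
        then have Ex: "lf E < x" using gen[OF E(1)] by force
        have hsE: "hs \<le> bt E" using left[OF E(1) Ex _ E(3)] E(4) i by force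
        have "E \<noteq> C" using E(4) by auto
        have "rt C \<le> lf E"
          using disjoint[OF E(1) Cn \<open>E \<noteq> C\<close>] hsE E S C in_strip[OF E(1)] Cpos by linarith
        then have "E \<in> ?K" using E Ex hsE S by simp
        with K[OF this] E(2) show False by simp
      qed
      have zq: "(x, q) \<in> outer" using q by (intro T_outer free_vertical) auto
      have Dx: "x < lf D" by (rule right[OF D(1) btD]) (use D S q in auto)
      have "\<exists>L M. sepD D L M \<and> (x, q) \<in> L"
      proof (rule left_of_chain[where b = "bt S"])
        show "False" if "E < n" "bt E < bt S" "snd (x, q) \<le> tp E" "lf E \<le> fst (x, q)" "fst (x, q) \<le> rt E" for E
          using right[OF that(1,2)] that Cx by simp
      qed (use outer_F[OF zq] D btD Dx S q in auto)
      then show False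
        using not_left_of_support_chain[OF zq S(1) D(1) _ _ D(2-4)] S q by auto
    qed
    show False
    proof (rule no_lower_fit[OF Cn, of "x - s C" q])
      show "False" if j: "j < n" "lf j < x - s C + s C" "x - s C < rt j" "bt j < q + s C" "q < tp j" for j
      proof (cases "bt j < hs")
        case True
        then show ?thesis using left[OF j(1) _ True] j i neg by force
      next
        case False
        have "j \<noteq> C" using j neg by auto
        have jt: "bt j < tp C" using j q C by (simp add: tp_def)
        have "rt C \<le> lf j"
          using disjoint[OF j(1) Cn \<open>j \<noteq> C\<close>] False jt j neg C in_strip[OF j(1)] Cpos by linarith
        then have "j \<in> ?K" using j False jt by simp
        then show ?thesis using none by blast
      qed
      show "0 \<le> x - s C" using neg Cpos by (simp add: rt_def)
    qed (use q C base in auto)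
  qed
  \<comment> \<open>\<open>C\<close> starts left of \<open>rho C\<close>, so its part beyond
    \<open>rho C\<close> is shorter than \<open>s C\<close>.\<close>
  then show ?thesis using i by (simp add: rt_def)
qed

text \<open>A vertical segment of \<open>T\<close> between the wall and the line ends on the bottom
  side of \<open>C\<close>.\<close>

lemma overhang_adjacent: "adjacent_sq s p C T"
proof -
  obtain i where i: "i < n" "rt i < x" "rt i = rho C" "rt i < rt C" "lf C < rt i"
    and wall: "\<And>D. D < n \<Longrightarrow> bt D < hs \<Longrightarrow> q \<le> tp D \<Longrightarrow> rt D < x \<Longrightarrow> rt D \<le> rho C"
    by (rule overhang_wall) blast
  obtain x' where x': "rt i < x'" "x' < min x (rt C)"
    using dense[of "rt i" "min x (rt C)"] i by auto
  have "(x', hs) \<in> closure T"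
  proof (rule closure_vertical[OF q(2)])
    fix t assume t: "q < t" "t < hs"
    show "(x', t) \<in> T"
    proof (rule free_slice)
      show "rt D < x'" if "D < n" "bt D \<le> t" "t \<le> tp D" "rt D < x" for D
        using wall[OF that(1) _ _ that(4)] that t x' i by simp
      show "0 \<le> x'" using in_strip[OF i(1)] x' by simp
    qed (use t q x' in auto)
  qed
  moreover have "(x', hs) \<in> sqr (p C) (s C)"
    using x' i C in_strip[OF C_facts(1)] by (simp add: mem_sqr)
  ultimately show ?thesis by (auto simp: adjacent_sq_def)
qed

text \<open>By \<open>profile\<close> and \<open>overhang_reach\<close> the distance from
  \<open>rho C\<close> to \<open>x\<close> is below \<open>2 * s C\<close> and bounds the depth
  under \<open>C\<close>. A shallow point lies in the row of copies below \<open>C\<close>; a deeper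
  one is itself a witness of \<open>trouble C\<close> and lies in the diagonal copy.\<close>

lemma covered_below_overhang: "covered (x, y)"
proof (rule ccontr)
  assume unc: "\<not> covered (x, y)"
  obtain i where i: "i < n" "bt i < hs" "hs \<le> tp i" "rt i < x" "rt i = rho C" "rt i < rt C" "lf C < rt i"
    and wall: "\<And>D. D < n \<Longrightarrow> bt D < hs \<Longrightarrow> q \<le> tp D \<Longrightarrow> rt D < x \<Longrightarrow> rt D \<le> rho C"
    by (rule overhang_wall) blast
  note Cn = C_facts(1)
  have profile: "min (tp S) hs - y \<le> x - rt S" if "S < n" "rt S < x" "bt S < hs" "y \<le> tp S" for S
    by (rule profile[OF unc _ _ that]) (use C in auto)
  have e: "hs - y \<le> x - rho C"
    using profile[OF i(1,4,2)] i q by simp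
  have deep: "y < hs - s C"
  proof (rule ccontr)
    assume "\<not> y < hs - s C"
    then have "covered (x, y)"
      using covered_below[OF Cn overhang_adjacent, of x y] overhang_reach i C C_facts by simp
    with unc show False by simp
  qed
  have "trouble C"
    unfolding trouble_def
  proof (intro exI conjI allI impI)
    show "(x, y) \<in> T" by (rule inT)
    show "rho C + s C < x" "y < bt C - s C" using e deep C by simp_all
    show "\<not> (lf E \<le> x \<and> x \<le> rt E)" if "E < n" "bt E < bt C" "y \<le> tp E" for E
      using no_straddle[OF that(1) _ _ that(3)] that(2) C by auto
    show "rt E \<le> rho C \<or> x < lf E" if E: "E < n" "bt E < bt C" "bt C \<le> tp E" for E
    proof (cases "x < lf E")
      case False
      then have "rt E < x" using no_straddle[OF E(1)] E C q by simp
      then show ?thesis using wall[OF E(1)] E C q by simp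
    qed simp
  qed
  moreover have "hs - y < 2 * s C"
  proof (rule ccontr)
    assume neg: "\<not> hs - y < 2 * s C"
    show False
    proof (rule column_no_fit[OF Cn, of "hs - s C"])
      show "rt D \<le> x - s C" if D: "D < n" "bt D \<le> hs - s C" "hs - s C \<le> tp D" "rt D < x" for D
        using profile[OF D(1,4)] D deep neg s_pos[OF Cn] by simp
      show "s C \<le> x" using e neg in_strip[OF i(1)] i s_pos[OF Cn] by simp
    qed (use deep C s_pos[OF Cn] in auto)
  qed
  ultimately have "covered (x, y)"
    using covered_trouble[OF Cn overhang_adjacent, of x y] overhang_reach e deep C by simp
  with unc show False by simp
qed

end

end

section \<open>From generic abscissas to the whole trench\<close>

context bl_trench
begin

lemma generic_covered:
  assumes T: "(x, y) \<in> T" and gen: "\<And>j. j < n \<Longrightarrow> lf j \<noteq> x \<and> rt j \<noteq> x" and y: "y \<le> H - 2 * hm"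
  shows "covered (x, y)"
proof (cases "\<exists>S. overhang x y S \<and> bt S \<le> H")
  case True
  let ?A = "{S. overhang x y S}"
  have "finite ?A" by (rule finite_subset[of _ "{..<n}"]) (auto simp: overhang_def)
  moreover have "?A \<noteq> {}" using True by blast
  ultimately obtain C where C: "overhang x y C" "\<forall>S. overhang x y S \<longrightarrow> bt C \<le> bt S"
    using finite_arg_min[of ?A bt] by blast
  interpret column W n s p T x y "bt C"
    by unfold_locales (use T gen C True in fastforce)+
  have "y < bt C" using C by (simp add: overhang_def)
  then obtain q where "y < q" "q < bt C" "\<forall>j<n. bt j < bt C \<longrightarrow> bt j < q" "\<forall>j<n. tp j < bt C \<longrightarrow> tp j < q"
    using near_below_edges by blast
  then show ?thesis using covered_below_overhang[OF C(1), of q] by blast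
next
  case False
  interpret column W n s p T x y H
    by unfold_locales (use T gen False in force)+
  show ?thesis using not_open_to_top y by blast
qed

lemma closed_covered: "closed {z. covered z}"
proof -
  have "{z. covered z} = (\<Union>S\<in>{S. S < n \<and> adjacent_sq s p S T}. \<Union>v\<in>shifts S. (\<lambda>z. z + v) ` sqr (p S) (s S))"
    by (auto simp: covered_def)
  moreover have "closed ((\<lambda>z. z + v) ` sqr (p S) (s S))" for v S
    using closed_translation[of "sqr (p S) (s S)" v]
    by (simp add: sqr_def closed_Times add.commute)
  ultimately show ?thesis
    by (auto simp: shifts_def intro!: closed_UN closed_Un)
qed

text \<open>Near an uncovered point of \<open>T\<close> everything is uncovered and outside the
  squares, so a small horizontal move to a generic abscissa stays in \<open>T\<close> and
  contradicts \<open>generic_covered\<close>.\<close>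

lemma all_covered:
  assumes T: "(x, y) \<in> T" and y: "y \<le> H - 2 * hm"
  shows "covered (x, y)"
proof (rule ccontr)
  assume "\<not> covered (x, y)"
  moreover have "open (- {z. covered z})" using closed_covered by (simp add: open_Compl)
  moreover have "closed (\<Union>j<n. sqr (p j) (s j))" by (auto simp: sqr_def intro!: closed_UN closed_Times)
  moreover note F = outer_F[OF T_outer[OF T]]
  ultimately have "open (- {z. covered z} - (\<Union>j<n. sqr (p j) (s j)))" "(x, y) \<in> - {z. covered z} - (\<Union>j<n. sqr (p j) (s j))"
    by (auto simp: F_def)
  then obtain e where e: "0 < e" "ball (x, y) e \<subseteq> - {z. covered z} - (\<Union>j<n. sqr (p j) (s j))"
    using open_contains_ball by blast
  have x: "0 \<le> x" "x \<le> W" "0 \<le> y" using F by (auto simp: F_iff)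
  \<comment> \<open>Clipped to the strip; being infinite, the interval contains an abscissa free of
    vertical edges.\<close>
  let ?I = "{max 0 (x - e)<..<min W (x + e)}"
  have "infinite ?I" using x e W_pos by (intro infinite_Ioo) auto
  moreover have "finite (lf ` {..<n} \<union> rt ` {..<n})" by simp
  ultimately obtain x' where x': "x' \<in> ?I" "x' \<notin> lf ` {..<n} \<union> rt ` {..<n}"
    by (meson finite_subset subsetI)
  have near: "(x'', y) \<in> ball (x, y) e" if "min x x' \<le> x''" "x'' \<le> max x x'" for x''
    using that x' e(1) by (auto simp: dist_Pair_Pair dist_real_def abs_less_iff)
  have "(x', y) \<in> T"
  proof (rule T_horizontal[OF T])
    fix x'' assume *: "min x x' \<le> x''" "x'' \<le> max x x'"
    then have "(x'', y) \<in> strip W" using x x' by (auto simp: strip_def)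
    then show "(x'', y) \<in> F" using near[OF *] e(2) unfolding F_def by blast
  qed
  then have "covered (x', y)" using x' y by (intro generic_covered) auto
  moreover have "(x', y) \<in> ball (x, y) e" by (rule near) auto
  ultimately show False using e(2) by blast
qed

lemma card_shifts: "finite (shifts S) \<and> card (shifts S) \<le> 4"
proof -
  have "card {a, b, c, d} \<le> 4" for a b c d :: "real \<times> real"
    using card_length[of "[a, b, c, d]"] by simp
  then show ?thesis by (simp add: shifts_def)
qed

end

theorem theorem11:
  fixes W :: real and n :: nat and s :: "nat \<Rightarrow> real" and p :: "nat \<Rightarrow> real \<times> real"
    and T :: "(real \<times> real) set"
  assumes "W > 0"
    and "\<forall>i<n. s i > 0"
    and "is_BL_packing W n s p"
    and "top_trench W n s p T"
  shows "\<exists>V :: nat \<Rightarrow> (real \<times> real) set.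
           (\<forall>i<n. finite (V i) \<and> card (V i) \<le> 4 \<and> (\<not> adjacent_sq s p i T \<longrightarrow> V i = {})) \<and>
           T \<inter> ({0..W} \<times> {0..h_BL n s p - 3 * h_max n s})
             \<subseteq> (\<Union>i\<in>{i. i < n \<and> adjacent_sq s p i T}. \<Union>v\<in>V i. (\<lambda>z. z + v) ` sqr (p i) (s i))"
proof -
  interpret bl_trench W n s p T
    by unfold_locales (use assms in auto)
  let ?V = "\<lambda>i. if adjacent_sq s p i T then shifts i else {}"
  show ?thesis
  proof (intro exI[of _ ?V] conjI allI impI)
    show "T \<inter> ({0..W} \<times> {0..h_BL n s p - 3 * h_max n s})
      \<subseteq> (\<Union>i\<in>{i. i < n \<and> adjacent_sq s p i T}. \<Union>v\<in>?V i. (\<lambda>z. z + v) ` sqr (p i) (s i))"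
    proof
      fix z assume "z \<in> T \<inter> ({0..W} \<times> {0..h_BL n s p - 3 * h_max n s})"
      then have "covered z" using all_covered[of "fst z" "snd z"] by auto
      then show "z \<in> (\<Union>i\<in>{i. i < n \<and> adjacent_sq s p i T}. \<Union>v\<in>?V i. (\<lambda>z. z + v) ` sqr (p i) (s i))"
        unfolding covered_def by auto
    qed
  qed (use card_shifts in auto)
qed

end
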